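(* (Young's inequality) Let $\nu>-\frac12$ and let $\mathbf{m}=\begin{pmatrix}a&b\\c&d\end{pmatrix}\in SL(2,\mathbb{R})$ with $b\neq0$. Suppose $1\le p,q,r\le\infty$ and $p^{-1}+q^{-1}=r^{-1}+1$. If $f\in\mathcal{L}_{p,\nu}$ and $g\in\mathcal{L}_{q,\nu}$, then $f\underset{\nu,\mathbf{m}}{*}g\in\mathcal{L}_{r,\nu}$ and $$\left\|f\underset{\nu,\mathbf{m}}{*}g\right\|_{r,\nu}\le\|f\|_{p,\nu}\,\|g\|_{q,\nu}.$$
   Context: $\mathcal{L}_{p,\nu}$ ($1\le p\le\infty$) is the Lebesgue space on $[0,+\infty[$ with norm $\|f\|_{p,\nu}=\left(\int_0^{+\infty}|f(y)|^py^{2\nu+1}dy\right)^{1/p}$ for $p<\infty$ and the essential sup norm for $p=\infty$ (also written $\|\cdot\|_{\infty,\nu}$). The Bessel translation is $T_x^\nu f(y)=\frac{\Gamma(\nu+1)}{\sqrt\pi\,\Gamma(\nu+1/2)}\int_0^\pi f\left(\sqrt{x^2+y^2-2xy\cos\theta}\right)(\sin\theta)^{2\nu}d\theta$ for $x,y\ge0$ (for $f\in\mathcal{L}_{p,\nu}$ it is defined for almost every $y$). The translation associated with $\mathbf{m}$ is $T_x^{\nu,\mathbf{m}}f(y)=e^{\frac i2\frac db(x^2+y^2)}T_x^\nu\left[s\mapsto e^{-\frac i2\frac db s^2}f(s)\right](y)$. The generalized convolution is $$\left(f\underset{\nu,\mathbf{m}}{*}g\right)(x)=\int_0^{+\infty}\left[T_x^{\nu,\mathbf{m}}f(y)\right]\left[e^{-i\frac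 db y^2}g(y)\right]y^{2\nu+1}dy$$ for all $x\ge 0$ such that the integral exists. *)

theory Defs
  imports "HOL-Analysis.Analysis" "HOL-Probability.Essential_Supremum"
begin

definition bessel_measure :: "real \<Rightarrow> real measure" where
  "bessel_measure \<nu> = density (lebesgue_on {0..}) (\<lambda>y. ennreal (y powr (2 * \<nu> + 1)))"

text \<open>
  Elements of the Lebesgue spaces are represented by functions; their values on the negative half
  line are irrelevant. The exponent ranges over the extended nonnegative reals, where
  \<open>inverse \<infinity> = 0\<close>. The real-valued norm is meaningful only for members of the space.
\<close>

definition bessel_Lp :: "real \<Rightarrow> ennreal \<Rightarrow> (real \<Rightarrow> complex) set" where
  "bessel_Lp \<nu> p =
    {f \<in> borel_measurable (bessel_measure \<nu>).
       if p = \<infinity> then esssup (bessel_measure \<nu>) (\<lambda>y. ereal (cmod (f y))) < \<infinity>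
       else integrable (bessel_measure \<nu>) (\<lambda>y. cmod (f y) powr enn2real p)}"

definition bessel_norm :: "real \<Rightarrow> ennreal \<Rightarrow> (real \<Rightarrow> complex) \<Rightarrow> real" where
  "bessel_norm \<nu> p f =
    (if p = \<infinity> then real_of_ereal (esssup (bessel_measure \<nu>) (\<lambda>y. ereal (cmod (f y))))
     else (LINT y|bessel_measure \<nu>. cmod (f y) powr enn2real p) powr (1 / enn2real p))"

text \<open>
  Library integrals are total, with value $0$ where the integrand is not integrable. The
  predicates \<open>bessel_translation_exists\<close> and \<open>gen_convolution_exists\<close> therefore record
  where the integrals really exist.
\<close>

definition bessel_translation_exists :: "real \<Rightarrow> real \<Rightarrow> (real \<Rightarrow> complex) \<Rightarrow> real \<Rightarrow> bool" where
  "bessel_translation_exists \<nu> x f y \<longleftrightarrow>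
    set_integrable lebesgue {0..pi}
      (\<lambda>\<theta>. f (sqrt (x\<^sup>2 + y\<^sup>2 - 2 * x * y * cos \<theta>)) * complex_of_real (sin \<theta> powr (2 * \<nu>)))"

definition bessel_translation :: "real \<Rightarrow> real \<Rightarrow> (real \<Rightarrow> complex) \<Rightarrow> real \<Rightarrow> complex" where
  "bessel_translation \<nu> x f y =
    complex_of_real (Gamma (\<nu> + 1) / (sqrt pi * Gamma (\<nu> + 1 / 2))) *
    (LINT \<theta>:{0..pi}|lebesgue.
      f (sqrt (x\<^sup>2 + y\<^sup>2 - 2 * x * y * cos \<theta>)) * complex_of_real (sin \<theta> powr (2 * \<nu>)))"

text \<open>
  For a matrix $m$ with rows $(a,b)$ and $(c,d)$, we have $b =$ \<open>m $ 1 $ 2\<close> and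
  $d =$ \<open>m $ 2 $ 2\<close>.
\<close>

definition gen_translation ::
    "real \<Rightarrow> real^2^2 \<Rightarrow> real \<Rightarrow> (real \<Rightarrow> complex) \<Rightarrow> real \<Rightarrow> complex" where
  "gen_translation \<nu> m x f y =
    cis (1 / 2 * (m $ 2 $ 2 / m $ 1 $ 2) * (x\<^sup>2 + y\<^sup>2)) *
    bessel_translation \<nu> x (\<lambda>s. cis (- (1 / 2 * (m $ 2 $ 2 / m $ 1 $ 2) * s\<^sup>2)) * f s) y"

definition gen_translation_exists ::
    "real \<Rightarrow> real^2^2 \<Rightarrow> real \<Rightarrow> (real \<Rightarrow> complex) \<Rightarrow> real \<Rightarrow> bool" where
  "gen_translation_exists \<nu> m x f y \<longleftrightarrow>
    bessel_translation_exists \<nu> x (\<lambda>s. cis (- (1 / 2 * (m $ 2 $ 2 / m $ 1 $ 2) * s\<^sup>2)) * f s) y"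

definition gen_convolution ::
    "real \<Rightarrow> real^2^2 \<Rightarrow> (real \<Rightarrow> complex) \<Rightarrow> (real \<Rightarrow> complex) \<Rightarrow> real \<Rightarrow> complex" where
  "gen_convolution \<nu> m f g x =
    (LINT y|bessel_measure \<nu>.
      gen_translation \<nu> m x f y * (cis (- (m $ 2 $ 2 / m $ 1 $ 2 * y\<^sup>2)) * g y))"

definition gen_convolution_exists ::
    "real \<Rightarrow> real^2^2 \<Rightarrow> (real \<Rightarrow> complex) \<Rightarrow> (real \<Rightarrow> complex) \<Rightarrow> real \<Rightarrow> bool" where
  "gen_convolution_exists \<nu> m f g x \<longleftrightarrow>
    (AE y in bessel_measure \<nu>. gen_translation_exists \<nu> m x f y) \<and>
    integrable (bessel_measure \<nu>)
      (\<lambda>y. gen_translation \<nu> m x f y * (cis (- (m $ 2 $ 2 / m $ 1 $ 2 * y\<^sup>2)) * g y))"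

end

theory Submission
  imports Defs "HOL-Probability.Probability_Measure" "HOL-Real_Asymp.Real_Asymp"
begin

text \<open>
  Two ideas carry the proof. First, multiplication by the chirp $e^{-\frac i2 \frac db s^2}$ turns
  the generalized convolution of $f$ and $g$ into the ordinary Bessel convolution of the two
  chirped functions, up to another unimodular factor (\<open>gen_convolution_eq\<close>). Chirps change
  neither moduli nor norms, so the matrix disappears and Young's inequality for the Bessel
  convolution remains (\<open>bessel_convolution_Young\<close>).

  Second, the Bessel translation averages $f$ over the third side
  $\sqrt{x^2 + y^2 - 2xy\cos\theta}$ of a triangle, with respect to a probability measure in the
  angle. Read $(y, \theta)$ as polar coordinates of a point $w$ of the upper half plane. The third
  side is then $|w - x|$, and the product of the radial weight $y^{2\nu+1}$ and the angular weight
  $(\sin\theta)^{2\nu}$ is the weight $({\rm Im}\,w)^{2\nu}$ with respect to area. Horizontal shifts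
  preserve it, so translation by $x$ preserves the integral with respect to $y$
  (\<open>nn_integral_bessel_translation\<close>). The third side is symmetric in $x$ and $y$, so
  integration over $x$ is invariant too.

  From there the classical proof of Young's inequality for groups applies. With
  $F = |f|$, $G = |g|$ and $s$ the third side, write
  \[ F(s) G(y) = (F(s)^p G(y)^q)^{1/r} \, (F(s)^p)^{1-1/q} \, (G(y)^q)^{1-1/p}. \]
  Hoelder's inequality with three factors (\<open>nn_integral_Holder3\<close>), used for each fixed $x$,
  bounds the convolution by a power of the convolution of $F^p$ and $G^q$, whose integral over $x$
  is $\|f\|_p^p \, \|g\|_q^q$ by invariance (\<open>nn_integral_nn_bessel_convolution\<close>).

  Functions that are only Lebesgue measurable are replaced by Borel representatives. By
  invariance, for every $x$ the third side avoids a given null set for almost all $(y, \theta)$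
  (\<open>AE_bessel_translation\<close>), so the replacement does not affect the convolution.
\<close>

section \<open>Substitution on open intervals and the mass of the angular weight\<close>

text \<open>
  The substitution rule on compact intervals passes to the open interval by monotone convergence.
  The derivative need not extend to the endpoints, and the image may be unbounded; the cotangent
  on $(0, \pi)$ is the case in point.
\<close>

lemma nn_integral_substitution_Ioo:
  fixes f :: "real \<Rightarrow> ennreal" and g g' :: "real \<Rightarrow> real"
  assumes [measurable]: "f \<in> borel_measurable borel"
    and deriv: "\<And>x. x \<in> {a<..<b} \<Longrightarrow> (g has_real_derivative g' x) (at x)"
    and cont: "continuous_on {a<..<b} g'"
    and nonneg: "\<And>x. x \<in> {a<..<b} \<Longrightarrow> 0 \<le> g' x"
    and "a < b"
  shows "(\<integral>\<^sup>+x. f x * indicator (g ` {a<..<b}) x \<partial>lborel) =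
    (\<integral>\<^sup>+x. f (g x) * g' x * indicator {a<..<b} x \<partial>lborel)"
proof -
  define h where "h n = (b - a) / (real n + 3)" for n
  have h_pos: "0 < h n" and h_small: "3 * h n \<le> b - a" for n
    using \<open>a < b\<close> by (auto simp: h_def field_simps mult_right_mono)
  have h_dec: "h n \<le> h m" if "m \<le> n" for m n
    unfolding h_def using \<open>a < b\<close> that by (intro divide_left_mono) auto
  have h_lim: "h \<longlonglongrightarrow> 0"
    unfolding h_def by real_asymp
  define I where "I n = {a + h n..b - h n}" for n
  have I_sub: "I n \<subseteq> {a<..<b}" for n
    using h_pos[of n] by (auto simp: I_def)
  have I_inc: "I m \<subseteq> I n" if "m \<le> n" for m n
    using h_dec[OF that] by (auto simp: I_def)
  have I_Un: "(\<Union>n. I n) = {a<..<b}"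
  proof (intro equalityI subsetI)
    fix x assume "x \<in> {a<..<b}"
    then have "0 < min (x - a) (b - x)" by auto
    from order_tendstoD(2)[OF h_lim this] obtain n where "h n < min (x - a) (b - x)"
      by (auto simp: eventually_sequentially)
    then show "x \<in> (\<Union>n. I n)" by (intro UN_I[of n]) (auto simp: I_def)
  qed (use I_sub in blast)
  have mono_g: "g x \<le> g y" if "a < x" "x \<le> y" "y < b" for x y
    using that by (intro DERIV_nonneg_imp_nondecreasing[of x y g]) (auto intro!: exI deriv nonneg)
  have cont_g: "continuous_on (I n) g" for n
    using I_sub[of n] by (intro continuous_at_imp_continuous_on ballI DERIV_isCont[OF deriv]) auto
  have g_I: "g ` I n = {g (a + h n)..g (b - h n)}" for n
  proof (intro equalityI subsetI)
    fix y assume "y \<in> {g (a + h n)..g (b - h n)}"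
    then show "y \<in> g ` I n"
      using IVT'[of g "a + h n" y "b - h n"] h_small[of n] h_pos[of n] cont_g[of n]
      by (auto simp: I_def)
  qed (use h_pos[of n] in \<open>auto simp: I_def intro!: mono_g\<close>)
  have [measurable]: "(\<lambda>x. f (g x) * g' x * indicator (I n) x) \<in> borel_measurable borel" for n
  proof -
    have "continuous_on (I n) g'" using cont I_sub by (rule continuous_on_subset)
    then have 1: "(\<lambda>x. indicator (I n) x *\<^sub>R g' x) \<in> borel_measurable borel"
      by (intro borel_measurable_continuous_on_indicator) (auto simp: I_def)
    have 2: "(\<lambda>x. indicator (I n) x *\<^sub>R g x) \<in> borel_measurable borel"
      using cont_g by (intro borel_measurable_continuous_on_indicator) (auto simp: I_def)
    have [measurable]: "I n \<in> sets borel" by (simp add: I_def)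
    have "(\<lambda>x. f (indicator (I n) x *\<^sub>R g x) * ennreal (indicator (I n) x *\<^sub>R g' x)
        * indicator (I n) x) \<in> borel_measurable borel"
      using 1 2 by measurable
    also have "(\<lambda>x. f (indicator (I n) x *\<^sub>R g x) * ennreal (indicator (I n) x *\<^sub>R g' x)
        * indicator (I n) x) = (\<lambda>x. f (g x) * g' x * indicator (I n) x)"
      by (auto simp: fun_eq_iff split: split_indicator)
    finally show ?thesis .
  qed
  have step: "(\<integral>\<^sup>+x. f x * indicator (g ` I n) x \<partial>lborel) =
      (\<integral>\<^sup>+x. f (g x) * g' x * indicator (I n) x \<partial>lborel)" for n
    unfolding g_I unfolding I_def
    using h_pos[of n] h_small[of n] I_sub[of n] 
    by (intro nn_integral_substitution_aux)
      (auto intro!: deriv nonneg continuous_on_subset[OF cont] simp: I_def)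
  have ind: "(SUP n. c * indicator (J n) x) = c * indicator (\<Union>n. J n) x"
    for J :: "nat \<Rightarrow> real set" and c :: ennreal and x
    by (auto split: split_indicator intro!: antisym SUP_least SUP_upper2 simp: indicator_def)
  have g_UN: "g ` {a<..<b} = (\<Union>n. g ` I n)"
    unfolding I_Un[symmetric] by auto
  have "(\<integral>\<^sup>+x. f x * indicator (g ` {a<..<b}) x \<partial>lborel) =
      (\<integral>\<^sup>+x. (SUP n. f x * indicator (g ` I n) x) \<partial>lborel)"
    by (simp add: ind g_UN)
  also have "\<dots> = (SUP n. \<integral>\<^sup>+x. f x * indicator (g ` I n) x \<partial>lborel)"
  proof (rule nn_integral_monotone_convergence_SUP)
    show "incseq (\<lambda>n x. f x * indicator (g ` I n) x)"
      using I_inc by (fastforce simp: incseq_def le_fun_def split: split_indicator)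
  qed (simp add: g_I)
  also have "\<dots> = (SUP n. \<integral>\<^sup>+x. f (g x) * g' x * indicator (I n) x \<partial>lborel)"
    by (simp add: step)
  also have "\<dots> = (\<integral>\<^sup>+x. (SUP n. f (g x) * g' x * indicator (I n) x) \<partial>lborel)"
  proof (rule nn_integral_monotone_convergence_SUP[symmetric])
    show "incseq (\<lambda>n x. f (g x) * g' x * indicator (I n) x)"
      using I_inc by (fastforce simp: incseq_def le_fun_def split: split_indicator)
  qed simp
  finally show ?thesis
    by (simp add: ind I_Un)
qed

text \<open>
  The substitution $t = (1 - \cos\theta)/2$ gives $t(1-t) = (\sin\theta/2)^2$ and turns the integral
  into $2^{2\nu} B(\nu + \frac12, \nu + \frac12)$; Legendre's duplication formula simplifies this
  to the stated quotient.
\<close>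

lemma nn_integral_sin_powr:
  fixes \<nu> :: real
  assumes "\<nu> > - 1 / 2"
  shows "(\<integral>\<^sup>+\<theta>. ennreal (indicator {0<..<pi} \<theta> * sin \<theta> powr (2 * \<nu>)) \<partial>lborel) =
    ennreal (sqrt pi * Gamma (\<nu> + 1 / 2) / Gamma (\<nu> + 1))"
proof -
  define a where "a = \<nu> + 1 / 2"
  have a: "a > 0" using assms by (simp add: a_def)
  define g where "g \<theta> = (1 - cos \<theta>) / 2" for \<theta> :: real
  define k where "k t = t powr (a - 1) * (1 - t) powr (a - 1)" for t :: real
  have [measurable]: "k \<in> borel_measurable borel" unfolding k_def by measurable
  have img: "g ` {0<..<pi} = {0<..<1}"
  proof (intro equalityI subsetI)
    fix t :: real assume t: "t \<in> {0<..<1}"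
    have "cos 0 > 1 - 2 * t" "cos pi < 1 - 2 * t" using t by auto
    then have "arccos (1 - 2 * t) \<in> {0<..<pi}" using t arccos_lt_bounded[of "1 - 2 * t"] by auto
    moreover have "t = g (arccos (1 - 2 * t))" using t by (simp add: g_def)
    ultimately show "t \<in> g ` {0<..<pi}" by blast
  next
    fix t assume "t \<in> g ` {0<..<pi}"
    then obtain \<theta> where "\<theta> \<in> {0<..<pi}" "t = g \<theta>" by auto
    then show "t \<in> {0<..<1}"
      using cos_monotone_0_pi[of 0 \<theta>] cos_monotone_0_pi[of \<theta> pi] by (auto simp: g_def)
  qed
  have k_sub: "k (g \<theta>) * (sin \<theta> / 2) = 2 powr (- (2 * \<nu>)) * sin \<theta> powr (2 * \<nu>)"
    if "\<theta> \<in> {0<..<pi}" for \<theta>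
  proof -
    have s: "sin \<theta> > 0" using that by (intro sin_gt_zero) auto
    have g: "0 < g \<theta>" "g \<theta> < 1" using img that by auto
    have "k (g \<theta>) = (g \<theta> * (1 - g \<theta>)) powr (a - 1)"
      using g by (simp add: k_def powr_mult)
    also have "g \<theta> * (1 - g \<theta>) = (sin \<theta> / 2)\<^sup>2"
      by (simp only: g_def power_divide sin_squared_eq) (simp add: power2_eq_square field_simps)
    also have "(sin \<theta> / 2)\<^sup>2 = (sin \<theta> / 2) powr 2"
      using s by (simp add: powr_numeral)
    also have "((sin \<theta> / 2) powr 2) powr (a - 1) = (sin \<theta> / 2) powr (2 * \<nu> - 1)"
      by (simp add: powr_powr a_def algebra_simps)
    finally have "k (g \<theta>) * (sin \<theta> / 2) = (sin \<theta> / 2) powr (2 * \<nu> - 1) * (sin \<theta> / 2) powr 1"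
      using s by simp
    also have "\<dots> = (sin \<theta> / 2) powr (2 * \<nu>)"
      by (subst powr_add[symmetric]) simp
    finally show ?thesis
      using s by (simp add: powr_divide powr_minus field_simps)
  qed
  have "(k has_integral Beta a a) {0..1}"
    unfolding k_def by (rule has_integral_Beta_real[OF a a])
  then have "(k has_integral Beta a a) {0<..<1}"
    by (rule has_integral_Icc_iff_Ioo[THEN iffD1])
  then have "ennreal (Beta a a) = (\<integral>\<^sup>+t. ennreal (indicator {0<..<1} t * k t) \<partial>lborel)"
    by (subst nn_integral_has_integral_lebesgue[of _ k]) (auto simp: k_def)
  also have "\<dots> = (\<integral>\<^sup>+t. ennreal (k t) * indicator (g ` {0<..<pi}) t \<partial>lborel)"
    unfolding img by (intro nn_integral_cong) (auto split: split_indicator)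
  also have "\<dots> = (\<integral>\<^sup>+\<theta>. ennreal (k (g \<theta>)) * ennreal (sin \<theta> / 2) * indicator {0<..<pi} \<theta> \<partial>lborel)"
    by (rule nn_integral_substitution_Ioo)
      (auto simp: g_def[abs_def] intro!: derivative_eq_intros continuous_intros sin_ge_zero)
  also have "\<dots> = (\<integral>\<^sup>+\<theta>. ennreal (2 powr (- (2 * \<nu>))) *
      ennreal (indicator {0<..<pi} \<theta> * sin \<theta> powr (2 * \<nu>)) \<partial>lborel)"
    using k_sub by (intro nn_integral_cong)
      (auto split: split_indicator simp: ennreal_mult'[symmetric] ennreal_mult''[symmetric] sin_ge_zero k_def)
  also have "\<dots> = ennreal (2 powr (- (2 * \<nu>))) *
      (\<integral>\<^sup>+\<theta>. ennreal (indicator {0<..<pi} \<theta> * sin \<theta> powr (2 * \<nu>)) \<partial>lborel)"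
    by (rule nn_integral_cmult) measurable
  finally have B: "ennreal (Beta a a) = ennreal (2 powr (- (2 * \<nu>))) *
      (\<integral>\<^sup>+\<theta>. ennreal (indicator {0<..<pi} \<theta> * sin \<theta> powr (2 * \<nu>)) \<partial>lborel)" .
  have "Gamma a * Gamma (a + 1 / 2) = 2 powr (1 - 2 * a) * sqrt pi * Gamma (2 * a)"
  proof -
    have "complex_of_real a \<notin> \<int>\<^sub>\<le>\<^sub>0" "complex_of_real a + 1 / 2 \<notin> \<int>\<^sub>\<le>\<^sub>0"
      using a by (auto elim!: nonpos_Ints_cases simp: complex_eq_iff)
    from Gamma_legendre_duplication[OF this]
    have "complex_of_real (Gamma a * Gamma (a + 1 / 2)) =
        complex_of_real (exp ((1 - 2 * a) * ln 2) * sqrt pi * Gamma (2 * a))"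
      by (simp add: Gamma_complex_of_real[symmetric] exp_of_real[symmetric])
    then show ?thesis
      by (simp only: of_real_eq_iff powr_def) simp
  qed
  moreover have "1 - 2 * a = - (2 * \<nu>)" "a + 1 / 2 = \<nu> + 1" by (simp_all add: a_def)
  ultimately have dup: "Gamma a * Gamma (\<nu> + 1) = 2 powr (- (2 * \<nu>)) * sqrt pi * Gamma (2 * a)"
    by simp
  have pos: "Gamma a > 0" "Gamma (2 * a) > 0" "Gamma (\<nu> + 1) > 0"
    using a assms by (auto intro!: Gamma_real_pos)
  have "Beta a a = 2 powr (- (2 * \<nu>)) * (sqrt pi * Gamma a / Gamma (\<nu> + 1))"
    using pos dup by (simp add: Beta_def field_simps)
  then have "ennreal (Beta a a) =
      ennreal (2 powr (- (2 * \<nu>))) * ennreal (sqrt pi * Gamma a / Gamma (\<nu> + 1))"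
    using pos by (subst ennreal_mult[symmetric]) auto
  with B have "ennreal (2 powr (- (2 * \<nu>))) * 
      (\<integral>\<^sup>+\<theta>. ennreal (indicator {0<..<pi} \<theta> * sin \<theta> powr (2 * \<nu>)) \<partial>lborel) =
      ennreal (2 powr (- (2 * \<nu>))) * ennreal (sqrt pi * Gamma a / Gamma (\<nu> + 1))"
    by simp
  then show ?thesis
    by (subst (asm) ennreal_mult_cancel_left) (auto simp: a_def)
qed

section \<open>Invariance of the Bessel measure under translation\<close>

text \<open>
  A Borel version of \<open>bessel_measure\<close>: products with it are taken over Borel sets, where
  Tonelli's theorem applies directly. Its density lives on the open half line because polar
  coordinates need a positive radius.
\<close>

definition radial_measure :: "real \<Rightarrow> real measure" where
  "radial_measure \<nu> = density lborel (\<lambda>y. ennreal (indicator {0<..} y * y powr (2 * \<nu> + 1)))"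

definition angular_density :: "real \<Rightarrow> real \<Rightarrow> real" where
  "angular_density \<nu> \<theta> =
    Gamma (\<nu> + 1) / (sqrt pi * Gamma (\<nu> + 1 / 2)) * (indicator {0<..<pi} \<theta> * sin \<theta> powr (2 * \<nu>))"

definition angular_measure :: "real \<Rightarrow> real measure" where
  "angular_measure \<nu> = density lborel (\<lambda>\<theta>. ennreal (angular_density \<nu> \<theta>))"

definition third_side :: "real \<Rightarrow> real \<Rightarrow> real \<Rightarrow> real" where
  "third_side x y \<theta> = sqrt (x\<^sup>2 + y\<^sup>2 - 2 * x * y * cos \<theta>)"

lemma measurable_angular_density [measurable]: "angular_density \<nu> \<in> borel_measurable borel"
  unfolding angular_density_def by measurable

lemma angular_const_pos:
  "\<nu> > - 1 / 2 \<Longrightarrow> Gamma (\<nu> + 1) / (sqrt pi * Gamma (\<nu> + 1 / 2)) > (0 :: real)"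
  by (intro divide_pos_pos mult_pos_pos Gamma_real_pos) auto

lemma angular_density_nonneg: "\<nu> > - 1 / 2 \<Longrightarrow> 0 \<le> angular_density \<nu> \<theta>"
  using angular_const_pos[of \<nu>] by (auto simp: angular_density_def simp del: times_divide_eq_left)

lemma sets_radial_measure [simp, measurable_cong]: "sets (radial_measure \<nu>) = sets borel"
  and space_radial_measure [simp]: "space (radial_measure \<nu>) = UNIV"
  and sets_angular_measure [simp, measurable_cong]: "sets (angular_measure \<nu>) = sets borel"
  and space_angular_measure [simp]: "space (angular_measure \<nu>) = UNIV"
  by (simp_all add: radial_measure_def angular_measure_def)

lemma sigma_finite_radial_measure: "sigma_finite_measure (radial_measure \<nu>)"
  unfolding radial_measure_def
  by (subst sigma_finite_measure.sigma_finite_iff_density_finite[OF sigma_finite_lborel]) auto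

interpretation radial: sigma_finite_measure "radial_measure \<nu>" for \<nu>
  by (rule sigma_finite_radial_measure)

lemma prob_space_angular_measure:
  assumes "\<nu> > - 1 / 2"
  shows "prob_space (angular_measure \<nu>)"
proof
  define c where "c = Gamma (\<nu> + 1) / (sqrt pi * Gamma (\<nu> + 1 / 2))"
  have c: "c > 0" using assms by (simp only: c_def angular_const_pos)
  have "emeasure (angular_measure \<nu>) (space (angular_measure \<nu>)) =
      (\<integral>\<^sup>+\<theta>. ennreal c * ennreal (indicator {0<..<pi} \<theta> * sin \<theta> powr (2 * \<nu>)) \<partial>lborel)"
    using c by (simp add: angular_measure_def emeasure_density angular_density_def c_def
        ennreal_mult' del: times_divide_eq_left)
  also have "\<dots> = ennreal c * ennreal (sqrt pi * Gamma (\<nu> + 1 / 2) / Gamma (\<nu> + 1))"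
    using assms by (simp add: nn_integral_cmult nn_integral_sin_powr)
  also have "\<dots> = ennreal (c * (sqrt pi * Gamma (\<nu> + 1 / 2) / Gamma (\<nu> + 1)))"
    using c by (rule ennreal_mult'[symmetric, OF less_imp_le])
  also have "c * (sqrt pi * Gamma (\<nu> + 1 / 2) / Gamma (\<nu> + 1)) = 1"
  proof -
    have "Gamma (\<nu> + 1) > 0" "Gamma (\<nu> + 1 / 2) > 0"
      using assms by (auto intro!: Gamma_real_pos)
    then show ?thesis by (auto simp: c_def)
  qed
  finally show "emeasure (angular_measure \<nu>) (space (angular_measure \<nu>)) = 1" by simp
qed

lemma sigma_finite_angular_measure:
  "\<nu> > - 1 / 2 \<Longrightarrow> sigma_finite_measure (angular_measure \<nu>)"
  by (intro prob_space_imp_sigma_finite prob_space_angular_measure)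

lemma measurable_third_side [measurable]:
  assumes [measurable]: "u \<in> borel_measurable M" "v \<in> borel_measurable M" "w \<in> borel_measurable M"
  shows "(\<lambda>t. third_side (u t) (v t) (w t)) \<in> borel_measurable M"
  unfolding third_side_def by measurable

lemma third_side_commute: "third_side x y \<theta> = third_side y x \<theta>"
  by (simp add: third_side_def algebra_simps)

text \<open>
  The third side is the distance from $x$, placed on the real axis, to the point of the upper half
  plane with polar coordinates $(y, \theta)$.
\<close>

lemma third_side_eq_dist: "third_side x y \<theta> = sqrt ((y * cos \<theta> - x)\<^sup>2 + (y * sin \<theta>)\<^sup>2)"
proof -
  have "(y * cos \<theta> - x)\<^sup>2 + (y * sin \<theta>)\<^sup>2 = x\<^sup>2 + y\<^sup>2 * ((sin \<theta>)\<^sup>2 + (cos \<theta>)\<^sup>2) - 2 * x * y * cos \<theta>"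
    unfolding power2_eq_square by algebra
  then show ?thesis by (simp add: third_side_def)
qed

lemma third_side_zero: "0 < y \<Longrightarrow> third_side 0 y \<theta> = y"
  by (simp add: third_side_def)

text \<open>
  The sign makes the substituted function increasing.
\<close>

lemma nn_integral_cot_substitution:
  assumes [measurable]: "f \<in> borel_measurable borel"
  shows "(\<integral>\<^sup>+t. f t \<partial>lborel) =
    (\<integral>\<^sup>+\<theta>. f (- cot \<theta>) * ennreal (inverse ((sin \<theta>)\<^sup>2)) * indicator {0<..<pi} \<theta> \<partial>lborel)"
proof -
  have "t \<in> (\<lambda>\<theta>. - cot \<theta>) ` {0<..<pi}" for t :: real
  proof
    show "t = - cot (arctan t + pi / 2)"
      using tan_arctan[of t] by (simp add: cot_def tan_def sin_add cos_add)
    show "arctan t + pi / 2 \<in> {0<..<pi}"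
      using arctan_bounded[of t] by auto
  qed
  then have img: "(\<lambda>\<theta>. - cot \<theta>) ` {0<..<pi} = (UNIV :: real set)" by blast
  have sin: "sin \<theta> \<noteq> 0" if "\<theta> \<in> {0<..<pi}" for \<theta> :: real
    using that sin_gt_zero[of \<theta>] by auto
  have "((\<lambda>\<theta>. - cot \<theta>) has_real_derivative inverse ((sin \<theta>)\<^sup>2)) (at \<theta>)"
    if "\<theta> \<in> {0<..<pi}" for \<theta> :: real
    using DERIV_minus[OF DERIV_cot[OF sin[OF that]]] by simp
  moreover have "continuous_on {0<..<pi} (\<lambda>\<theta> :: real. inverse ((sin \<theta>)\<^sup>2))"
    using sin by (intro continuous_intros) auto
  ultimately show ?thesis
    using nn_integral_substitution_Ioo[OF assms, of 0 pi "\<lambda>\<theta>. - cot \<theta>" "\<lambda>\<theta>. inverse ((sin \<theta>)\<^sup>2)"]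
    unfolding img by simp
qed

text \<open>
  Polar coordinates in two one-dimensional steps: $u = v\cot\theta$ on each horizontal line, and
  then, after exchanging the integrals, $v = \rho\sin\theta$ on each ray. The Jacobian is
  $v \sin^{-2}\theta \cdot \sin\theta = \rho$.
\<close>

lemma nn_integral_polar_upper_half_plane:
  fixes h :: "real \<times> real \<Rightarrow> ennreal"
  assumes [measurable]: "h \<in> borel_measurable borel"
  shows "(\<integral>\<^sup>+v. \<integral>\<^sup>+u. h (u, v) * indicator {0<..} v \<partial>lborel \<partial>lborel) =
    (\<integral>\<^sup>+\<rho>. \<integral>\<^sup>+\<theta>. h (\<rho> * cos \<theta>, \<rho> * sin \<theta>) * ennreal \<rho> * indicator {0<..<pi} \<theta>
      * indicator {0<..} \<rho> \<partial>lborel \<partial>lborel)"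
proof -
  have [measurable]: "(cot :: real \<Rightarrow> real) \<in> borel_measurable borel"
    unfolding cot_def[abs_def] by measurable
  note [measurable] = borel_prod[symmetric]
  have row: "(\<integral>\<^sup>+u. h (u, v) * indicator {0<..} v \<partial>lborel) =
      (\<integral>\<^sup>+\<theta>. h (v * cot \<theta>, v) * ennreal (v * inverse ((sin \<theta>)\<^sup>2)) * indicator {0<..<pi} \<theta>
        * indicator {0<..} v \<partial>lborel)" for v
  proof (cases "v > 0")
    case True
    have "(\<integral>\<^sup>+u. h (u, v) \<partial>lborel) = ennreal \<bar>- v\<bar> * (\<integral>\<^sup>+t. h (0 + (- v) * t, v) \<partial>lborel)"
      using True by (intro nn_integral_real_affine) auto
    also have "\<dots> = ennreal v * (\<integral>\<^sup>+t. h (- v * t, v) \<partial>lborel)"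
      using True by simp
    also have "(\<integral>\<^sup>+t. h (- v * t, v) \<partial>lborel) =
        (\<integral>\<^sup>+\<theta>. h (v * cot \<theta>, v) * ennreal (inverse ((sin \<theta>)\<^sup>2)) * indicator {0<..<pi} \<theta> \<partial>lborel)"
      by (subst nn_integral_cot_substitution) auto
    also have "ennreal v * \<dots> =
        (\<integral>\<^sup>+\<theta>. h (v * cot \<theta>, v) * ennreal (v * inverse ((sin \<theta>)\<^sup>2)) * indicator {0<..<pi} \<theta> \<partial>lborel)"
      using True by (subst nn_integral_cmult[symmetric])
        (auto intro!: nn_integral_cong simp: ennreal_mult' mult_ac)
    finally show ?thesis using True by simp
  qed simp
  have column: "(\<integral>\<^sup>+v. h (v * cot \<theta>, v) * ennreal (v * inverse ((sin \<theta>)\<^sup>2)) * indicator {0<..<pi} \<theta>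
        * indicator {0<..} v \<partial>lborel) =
      (\<integral>\<^sup>+\<rho>. h (\<rho> * cos \<theta>, \<rho> * sin \<theta>) * ennreal \<rho> * indicator {0<..<pi} \<theta>
      * indicator {0<..} \<rho> \<partial>lborel)" for \<theta>
  proof (cases "\<theta> \<in> {0<..<pi}")
    case True
    then have s: "sin \<theta> > 0" by (intro sin_gt_zero) auto
    have "(\<integral>\<^sup>+v. h (v * cot \<theta>, v) * ennreal (v * inverse ((sin \<theta>)\<^sup>2)) * indicator {0<..} v \<partial>lborel) =
      ennreal \<bar>sin \<theta>\<bar> * (\<integral>\<^sup>+\<rho>. h ((0 + sin \<theta> * \<rho>) * cot \<theta>, 0 + sin \<theta> * \<rho>)
        * ennreal ((0 + sin \<theta> * \<rho>) * inverse ((sin \<theta>)\<^sup>2)) * indicator {0<..} (0 + sin \<theta> * \<rho>) \<partial>lborel)"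
      using s by (intro nn_integral_real_affine) auto
    also have "\<dots> = (\<integral>\<^sup>+\<rho>. ennreal (sin \<theta>) * (h ((sin \<theta> * \<rho>) * cot \<theta>, sin \<theta> * \<rho>)
        * ennreal ((sin \<theta> * \<rho>) * inverse ((sin \<theta>)\<^sup>2)) * indicator {0<..} (sin \<theta> * \<rho>)) \<partial>lborel)"
      using s by (subst nn_integral_cmult) auto
    also have "\<dots> = (\<integral>\<^sup>+\<rho>. h (\<rho> * cos \<theta>, \<rho> * sin \<theta>) * ennreal \<rho> * indicator {0<..} \<rho> \<partial>lborel)"
    proof (intro nn_integral_cong)
      fix \<rho> :: real
      have 1: "ennreal (sin \<theta>) * ennreal ((sin \<theta> * \<rho>) * inverse ((sin \<theta>)\<^sup>2)) = ennreal \<rho>"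
        using s by (subst ennreal_mult'[symmetric]) (auto simp: power2_eq_square field_simps)
      have 2: "h ((sin \<theta> * \<rho>) * cot \<theta>, sin \<theta> * \<rho>) = h (\<rho> * cos \<theta>, \<rho> * sin \<theta>)"
        using s by (auto simp: cot_def mult_ac)
      have 3: "indicator {0<..} (sin \<theta> * \<rho>) = (indicator {0<..} \<rho> :: ennreal)"
        using s by (auto simp: indicator_def zero_less_mult_iff)
      have "a * (H * b * i) = H * (a * b) * i" for a H b i :: ennreal
        by (simp add: mult_ac)
      then show "ennreal (sin \<theta>) * (h ((sin \<theta> * \<rho>) * cot \<theta>, sin \<theta> * \<rho>)
        * ennreal ((sin \<theta> * \<rho>) * inverse ((sin \<theta>)\<^sup>2)) * indicator {0<..} (sin \<theta> * \<rho>)) =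
        h (\<rho> * cos \<theta>, \<rho> * sin \<theta>) * ennreal \<rho> * indicator {0<..} \<rho>"
        by (simp only: 1 2 3)
    qed
    finally show ?thesis using True by simp
  qed simp
  show ?thesis
    unfolding row
    by (subst lborel_pair.Fubini') (auto simp: column intro!: lborel_pair.Fubini')
qed

lemma nn_integral_angular:
  assumes "\<nu> > - 1 / 2" "h \<in> borel_measurable borel"
  shows "(\<integral>\<^sup>+\<theta>. h \<theta> \<partial>angular_measure \<nu>) = (\<integral>\<^sup>+\<theta>. ennreal (angular_density \<nu> \<theta>) * h \<theta> \<partial>lborel)"
  unfolding angular_measure_def using assms by (subst nn_integral_density) auto

lemma nn_integral_radial:
  assumes "h \<in> borel_measurable borel"
  shows "(\<integral>\<^sup>+y. h y \<partial>radial_measure \<nu>) =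
    (\<integral>\<^sup>+y. ennreal (indicator {0<..} y * y powr (2 * \<nu> + 1)) * h y \<partial>lborel)"
  unfolding radial_measure_def using assms by (subst nn_integral_density) auto

text \<open>
  In Cartesian coordinates $(u, v)$ of the half plane, $x$ enters only through the horizontal
  distance $u - x$.
\<close>

lemma nn_integral_translation_half_plane:
  assumes \<nu>: "\<nu> > - 1 / 2" and [measurable]: "F \<in> borel_measurable borel"
  shows "(\<integral>\<^sup>+y. \<integral>\<^sup>+\<theta>. F (third_side x y \<theta>) \<partial>angular_measure \<nu> \<partial>radial_measure \<nu>) =
    ennreal (Gamma (\<nu> + 1) / (sqrt pi * Gamma (\<nu> + 1 / 2))) *
    (\<integral>\<^sup>+v. \<integral>\<^sup>+u. F (sqrt ((u - x)\<^sup>2 + v\<^sup>2)) * ennreal (v powr (2 * \<nu>)) * indicator {0<..} v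
      \<partial>lborel \<partial>lborel)"
proof -
  define c where "c = Gamma (\<nu> + 1) / (sqrt pi * Gamma (\<nu> + 1 / 2))"
  have c: "c > 0" unfolding c_def by (rule angular_const_pos[OF \<nu>])
  interpret N: sigma_finite_measure "angular_measure \<nu>"
    by (rule sigma_finite_angular_measure[OF \<nu>])
  define h where "h w = F (sqrt ((fst w - x)\<^sup>2 + (snd w)\<^sup>2)) * ennreal (snd w powr (2 * \<nu>))" for w :: "real \<times> real"
  have [measurable]: "h \<in> borel_measurable borel"
    unfolding h_def borel_prod[symmetric] by measurable
  have pt: "ennreal (indicator {0<..} y * y powr (2 * \<nu> + 1)) *
        (ennreal (angular_density \<nu> \<theta>) * F (third_side x y \<theta>)) =
      ennreal c * (h (y * cos \<theta>, y * sin \<theta>) * ennreal y * indicator {0<..<pi} \<theta> * indicator {0<..} y)" for y \<theta>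
  proof (cases "y > 0 \<and> \<theta> \<in> {0<..<pi}")
    case True
    then have s: "sin \<theta> > 0" by (intro sin_gt_zero) auto
    have "y powr (2 * \<nu> + 1) * (c * sin \<theta> powr (2 * \<nu>)) = c * ((y * sin \<theta>) powr (2 * \<nu>) * y)"
      using True s by (simp add: powr_mult powr_add)
    then have "ennreal (y powr (2 * \<nu> + 1)) * ennreal (c * sin \<theta> powr (2 * \<nu>)) =
        ennreal c * (ennreal ((y * sin \<theta>) powr (2 * \<nu>)) * ennreal y)"
      using True c by (simp add: ennreal_mult'[symmetric] ennreal_mult''[symmetric])
    then have "ennreal (y powr (2 * \<nu> + 1)) * ennreal (c * sin \<theta> powr (2 * \<nu>)) * F (third_side x y \<theta>) =
        ennreal c * (ennreal ((y * sin \<theta>) powr (2 * \<nu>)) * ennreal y) * F (third_side x y \<theta>)"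
      by simp
    moreover have "angular_density \<nu> \<theta> = c * sin \<theta> powr (2 * \<nu>)"
      using True by (simp add: angular_density_def c_def)
    moreover have "h (y * cos \<theta>, y * sin \<theta>) = F (third_side x y \<theta>) * ennreal ((y * sin \<theta>) powr (2 * \<nu>))"
      by (simp add: h_def third_side_eq_dist)
    ultimately show ?thesis
      using True by (simp add: mult_ac)
  qed (auto simp: angular_density_def)
  have "(\<integral>\<^sup>+y. \<integral>\<^sup>+\<theta>. F (third_side x y \<theta>) \<partial>angular_measure \<nu> \<partial>radial_measure \<nu>) =
      (\<integral>\<^sup>+y. \<integral>\<^sup>+\<theta>. ennreal (indicator {0<..} y * y powr (2 * \<nu> + 1)) *
        (ennreal (angular_density \<nu> \<theta>) * F (third_side x y \<theta>)) \<partial>lborel \<partial>lborel)"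
    using \<nu> by (simp add: nn_integral_radial nn_integral_angular nn_integral_cmult)
  also have "\<dots> = ennreal c * (\<integral>\<^sup>+y. \<integral>\<^sup>+\<theta>. h (y * cos \<theta>, y * sin \<theta>) * ennreal y * indicator {0<..<pi} \<theta>
      * indicator {0<..} y \<partial>lborel \<partial>lborel)"
    unfolding pt borel_prod[symmetric] by (simp add: nn_integral_cmult)
  also have "\<dots> = ennreal c * (\<integral>\<^sup>+v. \<integral>\<^sup>+u. h (u, v) * indicator {0<..} v \<partial>lborel \<partial>lborel)"
    by (subst nn_integral_polar_upper_half_plane) auto
  finally show ?thesis by (simp add: h_def c_def)
qed

text \<open>
  Shifting $u$ by $x$ in the half plane reduces the claim to $x = 0$, where the third side is $y$
  for every angle and the angular measure has total mass $1$.
\<close>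

theorem nn_integral_bessel_translation:
  assumes \<nu>: "\<nu> > - 1 / 2" and [measurable]: "F \<in> borel_measurable borel"
  shows "(\<integral>\<^sup>+y. \<integral>\<^sup>+\<theta>. F (third_side x y \<theta>) \<partial>angular_measure \<nu> \<partial>radial_measure \<nu>) =
    (\<integral>\<^sup>+y. F y \<partial>radial_measure \<nu>)"
proof -
  interpret N: prob_space "angular_measure \<nu>" by (rule prob_space_angular_measure[OF \<nu>])
  have shift: "(\<integral>\<^sup>+u. F (sqrt ((u - x)\<^sup>2 + v\<^sup>2)) * ennreal (v powr (2 * \<nu>)) * indicator {0<..} v \<partial>lborel) =
      (\<integral>\<^sup>+u. F (sqrt ((u - 0)\<^sup>2 + v\<^sup>2)) * ennreal (v powr (2 * \<nu>)) * indicator {0<..} v \<partial>lborel)" for v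
    by (subst nn_integral_real_affine[of _ 1 x]) auto
  have "(\<integral>\<^sup>+y. \<integral>\<^sup>+\<theta>. F (third_side x y \<theta>) \<partial>angular_measure \<nu> \<partial>radial_measure \<nu>) =
      (\<integral>\<^sup>+y. \<integral>\<^sup>+\<theta>. F (third_side 0 y \<theta>) \<partial>angular_measure \<nu> \<partial>radial_measure \<nu>)"
    unfolding nn_integral_translation_half_plane[OF assms] shift ..
  also have "\<dots> = (\<integral>\<^sup>+y. F y \<partial>radial_measure \<nu>)"
  proof (rule nn_integral_cong_AE)
    have "AE y in radial_measure \<nu>. 0 < y"
      unfolding radial_measure_def by (subst AE_density) (auto split: split_indicator)
    then show "AE y in radial_measure \<nu>. (\<integral>\<^sup>+\<theta>. F (third_side 0 y \<theta>) \<partial>angular_measure \<nu>) = F y"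
      by (rule AE_mp) (use N.emeasure_space_1 in \<open>auto simp: third_side_zero\<close>)
  qed
  finally show ?thesis .
qed

section \<open>Young's inequality for nonnegative Borel functions\<close>

text \<open>
  With $L$ the weighted mean of the logarithms, the tangent of the exponential at $L$ gives
  $t \ge e^L (1 + \ln t - L)$; the logarithmic terms cancel in the weighted sum.
\<close>

lemma weighted_AM_GM3:
  fixes x y z \<alpha> \<beta> \<gamma> :: real
  assumes "0 \<le> x" "0 \<le> y" "0 \<le> z" "0 \<le> \<alpha>" "0 \<le> \<beta>" "0 \<le> \<gamma>" and sum: "\<alpha> + \<beta> + \<gamma> = 1"
  shows "x powr \<alpha> * y powr \<beta> * z powr \<gamma> \<le> \<alpha> * x + \<beta> * y + \<gamma> * z"
proof (cases "x = 0 \<or> y = 0 \<or> z = 0")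
  case True
  then show ?thesis using assms by auto
next
  case False
  then have pos: "x > 0" "y > 0" "z > 0" using assms by auto
  define L where "L = \<alpha> * ln x + \<beta> * ln y + \<gamma> * ln z"
  have tangent: "exp L * (1 + (ln t - L)) \<le> t" if "t > 0" for t
  proof -
    have "exp L * (1 + (ln t - L)) \<le> exp L * exp (ln t - L)"
      by (intro mult_left_mono exp_ge_add_one_self) auto
    also have "\<dots> = t" using that by (simp add: exp_diff)
    finally show ?thesis .
  qed
  have "x powr \<alpha> * y powr \<beta> * z powr \<gamma> = exp L"
    using pos by (simp add: powr_def L_def exp_add)
  also have "\<dots> = exp L * ((\<alpha> + \<beta> + \<gamma>) + L - (\<alpha> + \<beta> + \<gamma>) * L)"
    by (simp add: sum)
  also have "\<dots> = \<alpha> * (exp L * (1 + (ln x - L))) + \<beta> * (exp L * (1 + (ln y - L)))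
      + \<gamma> * (exp L * (1 + (ln z - L)))"
    unfolding L_def by algebra
  also have "\<dots> \<le> \<alpha> * x + \<beta> * y + \<gamma> * z"
    using assms pos by (intro add_mono mult_left_mono tangent) auto
  finally show ?thesis .
qed

text \<open>
  The functions are normalized by their integrals and the weighted inequality of arithmetic and
  geometric means is integrated pointwise. Zero weights are allowed: the convention
  \<open>0 powr 0 = 0\<close> is consistent on both sides, because a nonnegative function with integral
  zero vanishes almost everywhere.
\<close>

lemma nn_integral_Holder3:
  fixes U V W :: "'a \<Rightarrow> real"
  assumes [measurable]: "U \<in> borel_measurable M" "V \<in> borel_measurable M" "W \<in> borel_measurable M"
    and nn: "\<And>t. 0 \<le> U t" "\<And>t. 0 \<le> V t" "\<And>t. 0 \<le> W t"
    and int: "(\<integral>\<^sup>+t. U t \<partial>M) = ennreal a" "(\<integral>\<^sup>+t. V t \<partial>M) = ennreal b" "(\<integral>\<^sup>+t. W t \<partial>M) = ennreal c"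
    and abc: "0 \<le> a" "0 \<le> b" "0 \<le> c"
    and wt: "0 \<le> \<alpha>" "0 \<le> \<beta>" "0 \<le> \<gamma>" "\<alpha> + \<beta> + \<gamma> = 1"
  shows "(\<integral>\<^sup>+t. ennreal (U t powr \<alpha> * V t powr \<beta> * W t powr \<gamma>) \<partial>M) \<le>
    ennreal (a powr \<alpha> * b powr \<beta> * c powr \<gamma>)"
proof (cases "a = 0 \<or> b = 0 \<or> c = 0")
  case True
  moreover have "AE t in M. H t = 0" if "(\<integral>\<^sup>+t. H t \<partial>M) = ennreal 0" "\<And>t. 0 \<le> H t"
    "H \<in> borel_measurable M" for H :: "'a \<Rightarrow> real"
    using that by (simp add: nn_integral_0_iff_AE ennreal_eq_0_iff antisym_conv)
  ultimately have "(AE t in M. U t = 0) \<or> (AE t in M. V t = 0) \<or> (AE t in M. W t = 0)"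
    using int nn assms(1-3) by blast
  then have "AE t in M. ennreal (U t powr \<alpha> * V t powr \<beta> * W t powr \<gamma>) = 0"
    by (elim disjE) (auto elim: eventually_mono)
  then have "(\<integral>\<^sup>+t. ennreal (U t powr \<alpha> * V t powr \<beta> * W t powr \<gamma>) \<partial>M) = 0"
    by (subst nn_integral_0_iff_AE) auto
  then show ?thesis by simp
next
  case False
  then have pos: "a > 0" "b > 0" "c > 0" using abc by auto
  define D where "D = a powr \<alpha> * b powr \<beta> * c powr \<gamma>"
  have D: "0 \<le> D" by (simp add: D_def)
  have cancel: "ennreal (w / s) * ennreal s = ennreal w" if "0 < s" "0 \<le> w" for w s
    using that by (simp add: ennreal_mult'[symmetric])
  have "U t powr \<alpha> * V t powr \<beta> * W t powr \<gamma> \<le>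
      D * (\<alpha> / a * U t + \<beta> / b * V t + \<gamma> / c * W t)" for t
  proof -
    have "U t powr \<alpha> * V t powr \<beta> * W t powr \<gamma> =
        D * ((U t / a) powr \<alpha> * (V t / b) powr \<beta> * (W t / c) powr \<gamma>)"
      using pos nn by (simp add: powr_divide D_def)
    also have "\<dots> \<le> D * (\<alpha> * (U t / a) + \<beta> * (V t / b) + \<gamma> * (W t / c))"
      using pos nn wt by (intro mult_left_mono weighted_AM_GM3 D) auto
    finally show ?thesis by simp
  qed
  then have "(\<integral>\<^sup>+t. ennreal (U t powr \<alpha> * V t powr \<beta> * W t powr \<gamma>) \<partial>M) \<le>
      (\<integral>\<^sup>+t. ennreal (D * (\<alpha> / a * U t + \<beta> / b * V t + \<gamma> / c * W t)) \<partial>M)"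
    by (intro nn_integral_mono ennreal_leI)
  also have "\<dots> = (\<integral>\<^sup>+t. ennreal D * (ennreal (\<alpha> / a) * ennreal (U t) + ennreal (\<beta> / b) * ennreal (V t)
      + ennreal (\<gamma> / c) * ennreal (W t)) \<partial>M)"
    using pos nn wt D by (intro nn_integral_cong) (simp add: ennreal_mult'[symmetric] ennreal_plus[symmetric] del: ennreal_plus)
  also have "\<dots> = ennreal D * (ennreal (\<alpha> / a) * ennreal a + ennreal (\<beta> / b) * ennreal b
      + ennreal (\<gamma> / c) * ennreal c)"
    by (simp add: nn_integral_add nn_integral_cmult int)
  also have "\<dots> = ennreal D"
    using pos wt by (simp add: cancel ennreal_plus[symmetric] del: ennreal_plus)
  finally show ?thesis by (simp add: D_def)
qed

text \<open>
  The convolution of the moduli, with values in $[0, \infty]$: it exists everywhere and dominates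
  the convolution of the functions themselves.
\<close>

definition nn_bessel_convolution :: "real \<Rightarrow> (real \<Rightarrow> real) \<Rightarrow> (real \<Rightarrow> real) \<Rightarrow> real \<Rightarrow> ennreal" where
  "nn_bessel_convolution \<nu> F G x =
    (\<integral>\<^sup>+y. \<integral>\<^sup>+\<theta>. ennreal (F (third_side x y \<theta>) * G y) \<partial>angular_measure \<nu> \<partial>radial_measure \<nu>)"

context
  fixes \<nu> :: real
  assumes \<nu>: "\<nu> > - 1 / 2"
begin

interpretation angular: prob_space "angular_measure \<nu>"
  by (rule prob_space_angular_measure[OF \<nu>])

interpretation radial_pair: pair_sigma_finite "radial_measure \<nu>" "radial_measure \<nu>" ..

lemma measurable_nn_bessel_convolution:
  assumes [measurable]: "F \<in> borel_measurable borel" "G \<in> borel_measurable borel"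
  shows "nn_bessel_convolution \<nu> F G \<in> borel_measurable borel"
  unfolding nn_bessel_convolution_def[abs_def] by measurable

text \<open>
  By Tonelli the integral over $x$ may be taken first. It is then a translation of $F$ by $y$,
  because the third side is symmetric.
\<close>

lemma nn_integral_nn_bessel_convolution:
  assumes [measurable]: "F \<in> borel_measurable borel" "G \<in> borel_measurable borel"
    and nn: "\<And>t. 0 \<le> F t" "\<And>t. 0 \<le> G t"
  shows "(\<integral>\<^sup>+x. nn_bessel_convolution \<nu> F G x \<partial>radial_measure \<nu>) =
    (\<integral>\<^sup>+y. F y \<partial>radial_measure \<nu>) * (\<integral>\<^sup>+y. G y \<partial>radial_measure \<nu>)"
proof -
  have "(\<integral>\<^sup>+x. nn_bessel_convolution \<nu> F G x \<partial>radial_measure \<nu>) =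
      (\<integral>\<^sup>+y. \<integral>\<^sup>+x. \<integral>\<^sup>+\<theta>. ennreal (F (third_side x y \<theta>) * G y)
        \<partial>angular_measure \<nu> \<partial>radial_measure \<nu> \<partial>radial_measure \<nu>)"
    unfolding nn_bessel_convolution_def by (rule radial_pair.Fubini') measurable
  also have "\<dots> = (\<integral>\<^sup>+y. (\<integral>\<^sup>+x. \<integral>\<^sup>+\<theta>. ennreal (F (third_side y x \<theta>))
        \<partial>angular_measure \<nu> \<partial>radial_measure \<nu>) * ennreal (G y) \<partial>radial_measure \<nu>)"
    using nn by (simp add: ennreal_mult' nn_integral_multc third_side_commute)
  also have "\<dots> = (\<integral>\<^sup>+y. (\<integral>\<^sup>+x. F x \<partial>radial_measure \<nu>) * ennreal (G y) \<partial>radial_measure \<nu>)"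
    by (subst nn_integral_bessel_translation[OF \<nu>]) auto
  finally show ?thesis by (simp add: nn_integral_cmult)
qed

text \<open>
  Invariance for the indicator of an exceptional null set. This makes the value of the translation
  independent of the representative, for every $x$ and almost every $y$.
\<close>

lemma AE_bessel_translation:
  assumes "AE y in radial_measure \<nu>. P y"
  shows "AE y in radial_measure \<nu>. AE \<theta> in angular_measure \<nu>. P (third_side x y \<theta>)"
proof -
  from assms obtain Z where Z: "{y \<in> space (radial_measure \<nu>). \<not> P y} \<subseteq> Z"
    "emeasure (radial_measure \<nu>) Z = 0" "Z \<in> sets (radial_measure \<nu>)"
    by (rule AE_E)
  then have [measurable]: "Z \<in> sets borel" by simp
  have "(\<integral>\<^sup>+y. \<integral>\<^sup>+\<theta>. indicator Z (third_side x y \<theta>) \<partial>angular_measure \<nu> \<partial>radial_measure \<nu>) =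
      (\<integral>\<^sup>+y. indicator Z y \<partial>radial_measure \<nu>)"
    by (rule nn_integral_bessel_translation[OF \<nu>]) measurable
  also have "\<dots> = 0" using Z by simp
  finally have "AE y in radial_measure \<nu>.
      (\<integral>\<^sup>+\<theta>. indicator Z (third_side x y \<theta>) \<partial>angular_measure \<nu>) = 0"
    by (subst (asm) nn_integral_0_iff_AE) auto
  then show ?thesis
  proof eventually_elim
    case (elim y)
    then have "AE \<theta> in angular_measure \<nu>. indicator Z (third_side x y \<theta>) = (0 :: ennreal)"
      by (subst (asm) nn_integral_0_iff_AE) auto
    then show ?case
      by eventually_elim (use Z(1) in \<open>auto simp: indicator_def split: if_splits\<close>)
  qed
qed

context
  fixes F G :: "real \<Rightarrow> real"
  assumes meas [measurable]: "F \<in> borel_measurable borel" "G \<in> borel_measurable borel"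
    and nn: "\<And>t. 0 \<le> F t" "\<And>t. 0 \<le> G t"
begin

text \<open>
  Hoelder's inequality on the space of pairs $(y, \theta)$ for fixed $x$. The integral of
  $F(s)^p$ over this space is $P$ by invariance, and that of $G(y)^q$ is $Q$ because the angular
  measure is a probability measure. The third function $U$ remains free: it will be
  $F(s)^p G(y)^q$ when $r$ is finite.
\<close>

lemma nn_bessel_convolution_Holder:
  assumes P: "(\<integral>\<^sup>+y. ennreal (F y powr p) \<partial>radial_measure \<nu>) = ennreal P" "0 \<le> P"
    and Q: "(\<integral>\<^sup>+y. ennreal (G y powr q) \<partial>radial_measure \<nu>) = ennreal Q" "0 \<le> Q"
    and A: "(\<integral>\<^sup>+z. ennreal (U z) \<partial>(radial_measure \<nu> \<Otimes>\<^sub>M angular_measure \<nu>)) = ennreal a" "0 \<le> a"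
    and U: "U \<in> borel_measurable (borel \<Otimes>\<^sub>M borel)" "\<And>z. 0 \<le> U z"
    and wt: "0 \<le> \<alpha>" "0 \<le> \<beta>" "0 \<le> \<gamma>" "\<alpha> + \<beta> + \<gamma> = 1"
    and split: "\<And>y \<theta>. F (third_side x y \<theta>) * G y =
      U (y, \<theta>) powr \<alpha> * (F (third_side x y \<theta>) powr p) powr \<beta> * (G y powr q) powr \<gamma>"
  shows "nn_bessel_convolution \<nu> F G x \<le> ennreal (a powr \<alpha> * P powr \<beta> * Q powr \<gamma>)"
proof -
  define V where "V z = F (third_side x (fst z) (snd z)) powr p" for z
  define W where "W z = G (fst z) powr q" for z :: "real \<times> real"
  let ?M = "radial_measure \<nu> \<Otimes>\<^sub>M angular_measure \<nu>"
  have [measurable]: "U \<in> borel_measurable ?M" using U(1) by simp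
  have [measurable]: "V \<in> borel_measurable ?M" "W \<in> borel_measurable ?M"
    unfolding V_def W_def by measurable
  have V: "(\<integral>\<^sup>+z. ennreal (V z) \<partial>?M) = ennreal P"
  proof -
    have "(\<integral>\<^sup>+z. ennreal (V z) \<partial>?M) = (\<integral>\<^sup>+y. \<integral>\<^sup>+\<theta>. ennreal (F (third_side x y \<theta>) powr p)
        \<partial>angular_measure \<nu> \<partial>radial_measure \<nu>)"
      by (subst angular.nn_integral_fst[symmetric]) (auto simp: V_def)
    also have "\<dots> = ennreal P"
      by (subst nn_integral_bessel_translation[OF \<nu>]) (auto simp: P)
    finally show ?thesis .
  qed
  have W: "(\<integral>\<^sup>+z. ennreal (W z) \<partial>?M) = ennreal Q"
    using Q angular.emeasure_space_1
    by (subst angular.nn_integral_fst[symmetric]) (auto simp: W_def)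
  have "nn_bessel_convolution \<nu> F G x =
      (\<integral>\<^sup>+z. ennreal (U z powr \<alpha> * V z powr \<beta> * W z powr \<gamma>) \<partial>?M)"
    unfolding nn_bessel_convolution_def split
    by (subst angular.nn_integral_fst[symmetric]) (auto simp: V_def W_def)
  also have "\<dots> \<le> ennreal (a powr \<alpha> * P powr \<beta> * Q powr \<gamma>)"
    using A V W P Q U wt by (intro nn_integral_Holder3) (auto simp: V_def W_def)
  finally show ?thesis .
qed

text \<open>
  The case $r = \infty$ with finite $p$ and $q$. The weight $1/r$ is zero, and any $U$ that vanishes
  only together with $G$ can fill the first slot.
\<close>

lemma nn_bessel_convolution_le_conjugate:
  assumes pq: "1 \<le> p" "1 \<le> q" "1 / p + 1 / q = 1"
    and P: "(\<integral>\<^sup>+y. ennreal (F y powr p) \<partial>radial_measure \<nu>) = ennreal P" "0 \<le> P"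
    and Q: "(\<integral>\<^sup>+y. ennreal (G y powr q) \<partial>radial_measure \<nu>) = ennreal Q" "0 \<le> Q"
  shows "nn_bessel_convolution \<nu> F G x \<le> ennreal (P powr (1 / p) * Q powr (1 / q))"
proof -
  have "nn_bessel_convolution \<nu> F G x \<le> ennreal (Q powr 0 * P powr (1 / p) * Q powr (1 / q))"
  proof (rule nn_bessel_convolution_Holder[OF P Q, where U = "\<lambda>z. G (fst z) powr q"])
    show "(\<integral>\<^sup>+z. ennreal (G (fst z) powr q) \<partial>(radial_measure \<nu> \<Otimes>\<^sub>M angular_measure \<nu>)) = ennreal Q"
      using Q angular.emeasure_space_1 by (subst angular.nn_integral_fst[symmetric]) auto
    show "F (third_side x y \<theta>) * G y = (G (fst (y, \<theta>)) powr q) powr 0 *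
        (F (third_side x y \<theta>) powr p) powr (1 / p) * (G y powr q) powr (1 / q)" for y \<theta>
      using nn[of "third_side x y \<theta>"] nn[of y] pq by (simp add: powr_powr)
  qed (use Q pq in auto)
  then show ?thesis by (cases "Q = 0") auto
qed

text \<open>
  The case of three finite exponents. Where $A$, the convolution of $F^p$ and $G^q$, is finite, and
  hence almost everywhere, the convolution of $F$ and $G$ is at most
  $A^{1/r} P^{1-1/q} Q^{1-1/p}$. Since $A$ has integral $PQ$, the $r$-th power of this bound has
  integral $P^{r/p} Q^{r/q}$.
\<close>

lemma nn_bessel_convolution_Young:
  assumes pqr: "1 \<le> p" "1 \<le> q" "1 \<le> r" "1 / p + 1 / q = 1 / r + 1"
    and P: "(\<integral>\<^sup>+y. ennreal (F y powr p) \<partial>radial_measure \<nu>) = ennreal P" "0 \<le> P"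
    and Q: "(\<integral>\<^sup>+y. ennreal (G y powr q) \<partial>radial_measure \<nu>) = ennreal Q" "0 \<le> Q"
  shows "AE x in radial_measure \<nu>. nn_bessel_convolution \<nu> F G x < \<infinity>"
    and "(\<integral>\<^sup>+x. ennreal (enn2real (nn_bessel_convolution \<nu> F G x) powr r) \<partial>radial_measure \<nu>) \<le>
      ennreal ((P powr (1 / p) * Q powr (1 / q)) powr r)"
proof -
  define A where "A = nn_bessel_convolution \<nu> (\<lambda>t. F t powr p) (\<lambda>t. G t powr q)"
  define \<beta> where "\<beta> = 1 - 1 / q"
  define \<gamma> where "\<gamma> = 1 - 1 / p"
  have [measurable]: "A \<in> borel_measurable borel"
    unfolding A_def by (rule measurable_nn_bessel_convolution) measurable
  have A_int: "(\<integral>\<^sup>+x. A x \<partial>radial_measure \<nu>) = ennreal (P * Q)"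
    unfolding A_def by (subst nn_integral_nn_bessel_convolution) (auto simp: P Q ennreal_mult)
  have "(\<integral>\<^sup>+x. A x \<partial>radial_measure \<nu>) \<noteq> \<infinity>" by (simp add: A_int)
  then have A_fin: "AE x in radial_measure \<nu>. A x \<noteq> \<infinity>"
    by (intro nn_integral_PInf_AE) auto
  have \<beta>\<gamma>: "0 \<le> \<beta>" "0 \<le> \<gamma>" "1 / r + \<beta> + \<gamma> = 1"
    using pqr by (auto simp: \<beta>_def \<gamma>_def)
  have exps: "p * (1 / r + \<beta>) = 1" "q * (1 / r + \<gamma>) = 1"
  proof -
    have "1 / r + \<beta> = 1 / p" "1 / r + \<gamma> = 1 / q" using pqr by (auto simp: \<beta>_def \<gamma>_def)
    then show "p * (1 / r + \<beta>) = 1" "q * (1 / r + \<gamma>) = 1" using pqr by auto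
  qed
  have bound: "nn_bessel_convolution \<nu> F G x \<le> ennreal (enn2real (A x) powr (1 / r) * P powr \<beta> * Q powr \<gamma>)"
    if "A x \<noteq> \<infinity>" for x
  proof (rule nn_bessel_convolution_Holder[OF P Q, where
      U = "\<lambda>z. F (third_side x (fst z) (snd z)) powr p * G (fst z) powr q"])
    have "(\<integral>\<^sup>+z. ennreal (F (third_side x (fst z) (snd z)) powr p * G (fst z) powr q)
        \<partial>(radial_measure \<nu> \<Otimes>\<^sub>M angular_measure \<nu>)) = A x"
      by (subst angular.nn_integral_fst[symmetric]) (auto simp: A_def nn_bessel_convolution_def)
    then show "(\<integral>\<^sup>+z. ennreal (F (third_side x (fst z) (snd z)) powr p * G (fst z) powr q)
        \<partial>(radial_measure \<nu> \<Otimes>\<^sub>M angular_measure \<nu>)) = ennreal (enn2real (A x))"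
      using that by (simp add: ennreal_enn2real_if)
    fix y \<theta>
    define s where "s = F (third_side x y \<theta>)"
    define t where "t = G y"
    have st: "0 \<le> s" "0 \<le> t" using nn by (auto simp: s_def t_def)
    have "(s powr p * t powr q) powr (1 / r) * (s powr p) powr \<beta> * (t powr q) powr \<gamma> =
        s powr (p * (1 / r + \<beta>)) * t powr (q * (1 / r + \<gamma>))"
      using st by (simp add: powr_mult powr_powr powr_add distrib_left)
    also have "\<dots> = s * t" using st by (simp add: exps)
    finally show "F (third_side x y \<theta>) * G y =
        (F (third_side x (fst (y, \<theta>)) (snd (y, \<theta>))) powr p * G (fst (y, \<theta>)) powr q) powr (1 / r) *
        (F (third_side x y \<theta>) powr p) powr \<beta> * (G y powr q) powr \<gamma>"
      by (simp add: s_def t_def)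
  qed (use pqr \<beta>\<gamma> in auto)
  show "AE x in radial_measure \<nu>. nn_bessel_convolution \<nu> F G x < \<infinity>"
    using A_fin
  proof eventually_elim
    case (elim x)
    show ?case using bound[OF elim] by (rule le_less_trans) simp
  qed
  have "(\<integral>\<^sup>+x. ennreal (enn2real (nn_bessel_convolution \<nu> F G x) powr r) \<partial>radial_measure \<nu>) \<le>
      (\<integral>\<^sup>+x. A x * ennreal (P powr (r * \<beta>) * Q powr (r * \<gamma>)) \<partial>radial_measure \<nu>)"
  proof (rule nn_integral_mono_AE)
    show "AE x in radial_measure \<nu>. ennreal (enn2real (nn_bessel_convolution \<nu> F G x) powr r) \<le>
        A x * ennreal (P powr (r * \<beta>) * Q powr (r * \<gamma>))"
      using A_fin
    proof eventually_elim
      case (elim x)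
      have "enn2real (nn_bessel_convolution \<nu> F G x) \<le> enn2real (A x) powr (1 / r) * P powr \<beta> * Q powr \<gamma>"
        using bound[OF elim] by (intro enn2real_leI) auto
      then have "enn2real (nn_bessel_convolution \<nu> F G x) powr r \<le>
          (enn2real (A x) powr (1 / r) * P powr \<beta> * Q powr \<gamma>) powr r"
        using pqr by (intro powr_mono2) auto
      also have "\<dots> = enn2real (A x) * (P powr (r * \<beta>) * Q powr (r * \<gamma>))"
        using pqr by (simp add: powr_mult powr_powr mult_ac)
      finally have "ennreal (enn2real (nn_bessel_convolution \<nu> F G x) powr r) \<le>
          ennreal (enn2real (A x)) * ennreal (P powr (r * \<beta>) * Q powr (r * \<gamma>))"
        by (subst ennreal_mult'[symmetric]) (auto intro: ennreal_leI)
      then show ?case using elim by (simp add: ennreal_enn2real_if)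
    qed
  qed
  also have "\<dots> = ennreal (P * Q) * ennreal (P powr (r * \<beta>) * Q powr (r * \<gamma>))"
    by (simp add: nn_integral_multc A_int)
  also have "\<dots> = ennreal ((P * P powr (r * \<beta>)) * (Q * Q powr (r * \<gamma>)))"
    using P Q by (subst ennreal_mult'[symmetric]) (auto simp: mult_ac)
  also have "P * P powr (r * \<beta>) = P powr (r / p)"
  proof -
    have "1 + r * \<beta> = r / p" using pqr by (simp add: \<beta>_def field_simps)
    then show ?thesis using P powr_add[of P 1 "r * \<beta>"] by (cases "P = 0") auto
  qed
  also have "Q * Q powr (r * \<gamma>) = Q powr (r / q)"
  proof -
    have "1 + r * \<gamma> = r / q" using pqr by (simp add: \<gamma>_def field_simps)
    then show ?thesis using Q powr_add[of Q 1 "r * \<gamma>"] by (cases "Q = 0") auto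
  qed
  also have "P powr (r / p) * Q powr (r / q) = (P powr (1 / p) * Q powr (1 / q)) powr r"
    by (simp add: powr_mult powr_powr)
  finally show "(\<integral>\<^sup>+x. ennreal (enn2real (nn_bessel_convolution \<nu> F G x) powr r) \<partial>radial_measure \<nu>) \<le>
      ennreal ((P powr (1 / p) * Q powr (1 / q)) powr r)" .
qed

lemma nn_bessel_convolution_le_bounded_left:
  assumes "\<And>t. F t \<le> C" "(\<integral>\<^sup>+y. ennreal (G y) \<partial>radial_measure \<nu>) = ennreal Q" "0 \<le> C"
  shows "nn_bessel_convolution \<nu> F G x \<le> ennreal (C * Q)"
proof -
  have "nn_bessel_convolution \<nu> F G x \<le>
      (\<integral>\<^sup>+y. \<integral>\<^sup>+\<theta>. ennreal C * ennreal (G y) \<partial>angular_measure \<nu> \<partial>radial_measure \<nu>)"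
    unfolding nn_bessel_convolution_def using assms nn
    by (intro nn_integral_mono) (auto simp: ennreal_mult'[symmetric] intro!: ennreal_leI mult_right_mono)
  also have "\<dots> = ennreal C * ennreal Q"
    using angular.emeasure_space_1 by (simp add: nn_integral_cmult assms)
  finally show ?thesis using assms by (simp add: ennreal_mult')
qed

lemma nn_bessel_convolution_le_bounded_right:
  assumes "\<And>t. G t \<le> C" "(\<integral>\<^sup>+y. ennreal (F y) \<partial>radial_measure \<nu>) = ennreal P" "0 \<le> C"
  shows "nn_bessel_convolution \<nu> F G x \<le> ennreal (P * C)"
proof -
  have "nn_bessel_convolution \<nu> F G x \<le>
      (\<integral>\<^sup>+y. \<integral>\<^sup>+\<theta>. ennreal (F (third_side x y \<theta>)) * ennreal C \<partial>angular_measure \<nu> \<partial>radial_measure \<nu>)"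
    unfolding nn_bessel_convolution_def using assms nn
    by (intro nn_integral_mono) (auto simp: ennreal_mult''[symmetric] intro!: ennreal_leI mult_left_mono)
  also have "\<dots> = (\<integral>\<^sup>+y. \<integral>\<^sup>+\<theta>. ennreal (F (third_side x y \<theta>)) \<partial>angular_measure \<nu> \<partial>radial_measure \<nu>) * ennreal C"
    by (simp add: nn_integral_multc)
  also have "\<dots> = ennreal P * ennreal C"
    by (subst nn_integral_bessel_translation[OF \<nu>]) (auto simp: assms)
  finally show ?thesis using assms by (simp add: ennreal_mult'')
qed

end
end

section \<open>From Lebesgue measurable functions to Borel representatives\<close>

lemma borel_measurable_lebesgue_onI:
  "h \<in> borel_measurable borel \<Longrightarrow> h \<in> borel_measurable (lebesgue_on S)"
  by (rule measurable_restrict_space1, rule measurable_completion, simp)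

lemma AE_radial_measure_iff: "(AE y in radial_measure \<nu>. P y) \<longleftrightarrow> (AE y in lborel. 0 < y \<longrightarrow> P y)"
  unfolding radial_measure_def by (subst AE_density) (auto intro!: AE_cong split: split_indicator)

text \<open>
  Completing Lebesgue measure adds only subsets of null sets, and the endpoint $0$ is a null set.
\<close>

lemma AE_bessel_measure_iff: "(AE y in bessel_measure \<nu>. P y) \<longleftrightarrow> (AE y in radial_measure \<nu>. P y)"
proof -
  have [measurable]: "(\<lambda>y. y powr (2 * \<nu> + 1)) \<in> borel_measurable (lebesgue_on {0..})"
    by (rule borel_measurable_lebesgue_onI) measurable
  have "(AE y in bessel_measure \<nu>. P y) \<longleftrightarrow>
      (AE y in lebesgue. y \<in> {0..} \<longrightarrow> 0 < ennreal (y powr (2 * \<nu> + 1)) \<longrightarrow> P y)"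
    unfolding bessel_measure_def by (subst AE_density) (auto simp: AE_restrict_space_iff)
  also have "\<dots> \<longleftrightarrow> (AE y in lborel. y \<in> {0..} \<longrightarrow> 0 < ennreal (y powr (2 * \<nu> + 1)) \<longrightarrow> P y)"
    by (rule AE_completion_iff)
  also have "\<dots> \<longleftrightarrow> (AE y in radial_measure \<nu>. P y)"
    unfolding AE_radial_measure_iff by (intro AE_cong) auto
  finally show ?thesis .
qed

lemma borel_measurable_bessel_measure_iff:
  fixes f :: "real \<Rightarrow> 'b :: real_normed_vector"
  shows "f \<in> borel_measurable (bessel_measure \<nu>) \<longleftrightarrow> (\<lambda>y. indicator {0..} y *\<^sub>R f y) \<in> borel_measurable lebesgue"
  unfolding bessel_measure_def by (simp add: borel_measurable_restrict_space_iff)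

lemma borel_measurable_bessel_measureI:
  "f \<in> borel_measurable borel \<Longrightarrow> f \<in> borel_measurable (bessel_measure \<nu>)"
  unfolding bessel_measure_def
  by (subst measurable_cong_sets[OF sets_density refl]) (rule borel_measurable_lebesgue_onI)

lemma borel_measurable_bessel_measure_AE:
  fixes f f' :: "real \<Rightarrow> 'b :: euclidean_space"
  assumes [measurable]: "f' \<in> borel_measurable borel" and ae: "AE y in radial_measure \<nu>. f y = f' y"
  shows "f \<in> borel_measurable (bessel_measure \<nu>)"
  unfolding borel_measurable_bessel_measure_iff
proof (rule borel_measurable_AE)
  show "(\<lambda>y. indicator {0..} y *\<^sub>R f' y) \<in> borel_measurable lebesgue"
    by (rule measurable_completion) measurable
  have "AE y in lborel. y \<noteq> (0 :: real)" by (rule AE_lborel_singleton)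
  then have "AE y in lborel. indicator {0..} y *\<^sub>R f' y = indicator {0..} y *\<^sub>R f y"
    using ae unfolding AE_radial_measure_iff by eventually_elim (auto split: split_indicator)
  then show "AE y in lebesgue. indicator {0..} y *\<^sub>R f' y = indicator {0..} y *\<^sub>R f y"
    by (rule AE_completion)
qed

lemma ex_borel_representative:
  fixes f :: "real \<Rightarrow> complex"
  assumes "f \<in> borel_measurable (bessel_measure \<nu>)"
  obtains f' where "f' \<in> borel_measurable borel" "AE y in radial_measure \<nu>. f y = f' y"
proof -
  define h where "h y = indicator {0..} y *\<^sub>R f y" for y
  have h: "h \<in> borel_measurable lebesgue"
    using assms unfolding borel_measurable_bessel_measure_iff h_def[abs_def] .
  have "(\<lambda>y. Re (h y)) \<in> borel_measurable lebesgue" "(\<lambda>y. Im (h y)) \<in> borel_measurable lebesgue"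
    using h by measurable
  from this[THEN completion_ex_borel_measurable_real]
  obtain u v where [measurable]: "u \<in> borel_measurable lborel" "v \<in> borel_measurable lborel"
    and uv: "AE y in lborel. Re (h y) = u y" "AE y in lborel. Im (h y) = v y"
    by auto
  show ?thesis
  proof
    show "(\<lambda>y. Complex (u y) (v y)) \<in> borel_measurable borel"
      unfolding Complex_eq by measurable
    show "AE y in radial_measure \<nu>. f y = Complex (u y) (v y)"
      unfolding AE_radial_measure_iff using uv
      by eventually_elim (auto simp: h_def complex_eq_iff)
  qed
qed

lemma nn_integral_bessel_measure:
  assumes [measurable]: "h \<in> borel_measurable borel"
  shows "(\<integral>\<^sup>+y. h y \<partial>bessel_measure \<nu>) = (\<integral>\<^sup>+y. h y \<partial>radial_measure \<nu>)"
proof -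
  have [measurable]: "(\<lambda>y. y powr (2 * \<nu> + 1)) \<in> borel_measurable (lebesgue_on {0..})"
    "h \<in> borel_measurable (lebesgue_on {0..})"
    by (rule borel_measurable_lebesgue_onI; measurable)+
  have "(\<integral>\<^sup>+y. h y \<partial>bessel_measure \<nu>) =
      (\<integral>\<^sup>+y. ennreal (y powr (2 * \<nu> + 1)) * h y * indicator {0..} y \<partial>lborel)"
    unfolding bessel_measure_def
    by (subst nn_integral_density) (auto simp: nn_integral_restrict_space nn_integral_completion)
  also have "\<dots> = (\<integral>\<^sup>+y. h y \<partial>radial_measure \<nu>)"
    unfolding nn_integral_radial[OF assms]
    by (intro nn_integral_cong) (auto split: split_indicator)
  finally show ?thesis .
qed

lemma
  fixes f f' :: "real \<Rightarrow> complex"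
  assumes [measurable]: "f' \<in> borel_measurable borel" and ae: "AE y in radial_measure \<nu>. f y = f' y"
  shows integrable_bessel_measure_iff:
      "integrable (bessel_measure \<nu>) f \<longleftrightarrow> integrable (radial_measure \<nu>) f'"
    and integral_bessel_measure: "(LINT y|bessel_measure \<nu>. f y) = (LINT y|radial_measure \<nu>. f' y)"
proof -
  have m [measurable]: "f \<in> borel_measurable (bessel_measure \<nu>)" "f' \<in> borel_measurable (bessel_measure \<nu>)"
    by (rule borel_measurable_bessel_measure_AE[OF assms], rule borel_measurable_bessel_measureI[OF assms(1)])
  have ae': "AE y in bessel_measure \<nu>. f y = f' y"
    using ae by (simp add: AE_bessel_measure_iff)
  have "integrable (bessel_measure \<nu>) f \<longleftrightarrow> integrable (bessel_measure \<nu>) f'"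
    by (rule integrable_cong_AE[OF m ae'])
  also have "\<dots> \<longleftrightarrow> integrable (radial_measure \<nu>) f'"
    using m by (simp add: integrable_iff_bounded nn_integral_bessel_measure)
  finally show "integrable (bessel_measure \<nu>) f \<longleftrightarrow> integrable (radial_measure \<nu>) f'" .
  have [measurable]: "(\<lambda>y. y powr (2 * \<nu> + 1)) \<in> borel_measurable (lebesgue_on {0..})"
    "f' \<in> borel_measurable (lebesgue_on {0..})"
    by (rule borel_measurable_lebesgue_onI; measurable)+
  have "(LINT y|bessel_measure \<nu>. f y) = (LINT y|bessel_measure \<nu>. f' y)"
    by (rule integral_cong_AE[OF m ae'])
  also have "\<dots> = (LINT y|lebesgue_on {0..}. y powr (2 * \<nu> + 1) *\<^sub>R f' y)"
    unfolding bessel_measure_def by (rule integral_density) auto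
  also have "\<dots> = (LINT y|lebesgue. indicator {0..} y *\<^sub>R (y powr (2 * \<nu> + 1) *\<^sub>R f' y))"
    by (rule integral_restrict_space) simp
  also have "\<dots> = (LINT y|lborel. indicator {0..} y *\<^sub>R (y powr (2 * \<nu> + 1) *\<^sub>R f' y))"
    by (rule integral_completion) measurable
  also have "\<dots> = (LINT y|lborel. (indicator {0<..} y * y powr (2 * \<nu> + 1)) *\<^sub>R f' y)"
    by (intro Bochner_Integration.integral_cong) (auto split: split_indicator)
  also have "\<dots> = (LINT y|radial_measure \<nu>. f' y)"
    unfolding radial_measure_def by (rule integral_density[symmetric]) auto
  finally show "(LINT y|bessel_measure \<nu>. f y) = (LINT y|radial_measure \<nu>. f' y)" .
qed

lemma bessel_Lp_finiteD:
  assumes f: "f \<in> bessel_Lp \<nu> (ennreal p)" and "0 < p"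
    and [measurable]: "f' \<in> borel_measurable borel" and ae: "AE y in radial_measure \<nu>. f y = f' y"
  obtains P where "0 \<le> P" "(\<integral>\<^sup>+y. ennreal (cmod (f' y) powr p) \<partial>radial_measure \<nu>) = ennreal P"
    "bessel_norm \<nu> (ennreal p) f = P powr (1 / p)"
proof
  define P where "P = (LINT y|bessel_measure \<nu>. cmod (f y) powr p)"
  have int: "integrable (bessel_measure \<nu>) (\<lambda>y. cmod (f y) powr p)"
    using f \<open>0 < p\<close> by (auto simp: bessel_Lp_def)
  show "0 \<le> P" by (simp add: P_def)
  show "bessel_norm \<nu> (ennreal p) f = P powr (1 / p)"
    using \<open>0 < p\<close> by (simp add: bessel_norm_def P_def)
  have "(\<integral>\<^sup>+y. ennreal (cmod (f' y) powr p) \<partial>radial_measure \<nu>) =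
      (\<integral>\<^sup>+y. ennreal (cmod (f' y) powr p) \<partial>bessel_measure \<nu>)"
    by (subst nn_integral_bessel_measure) auto
  also have "\<dots> = (\<integral>\<^sup>+y. ennreal (cmod (f y) powr p) \<partial>bessel_measure \<nu>)"
    using ae by (intro nn_integral_cong_AE) (auto simp: AE_bessel_measure_iff elim: eventually_mono)
  also have "\<dots> = ennreal P"
    unfolding P_def using int by (intro nn_integral_eq_integral) auto
  finally show "(\<integral>\<^sup>+y. ennreal (cmod (f' y) powr p) \<partial>radial_measure \<nu>) = ennreal P" .
qed

lemma bessel_Lp_finiteI:
  assumes h: "h \<in> borel_measurable (bessel_measure \<nu>)"
    and le: "AE y in radial_measure \<nu>. cmod (h y) \<le> k y"
    and [measurable]: "k \<in> borel_measurable borel"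
    and int: "(\<integral>\<^sup>+y. ennreal (k y powr r) \<partial>radial_measure \<nu>) \<le> ennreal (D powr r)"
    and "0 \<le> D" "0 < r"
  shows "h \<in> bessel_Lp \<nu> (ennreal r)" and "bessel_norm \<nu> (ennreal r) h \<le> D"
proof -
  note [measurable] = h
  have "(\<integral>\<^sup>+y. ennreal (cmod (h y) powr r) \<partial>bessel_measure \<nu>) \<le>
      (\<integral>\<^sup>+y. ennreal (k y powr r) \<partial>bessel_measure \<nu>)"
    using le \<open>0 < r\<close> by (intro nn_integral_mono_AE)
      (auto simp: AE_bessel_measure_iff elim!: eventually_mono intro!: ennreal_leI powr_mono2)
  also have "\<dots> \<le> ennreal (D powr r)"
    using int by (simp add: nn_integral_bessel_measure)
  finally have *: "(\<integral>\<^sup>+y. ennreal (cmod (h y) powr r) \<partial>bessel_measure \<nu>) \<le> ennreal (D powr r)" .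
  then have "(\<integral>\<^sup>+y. ennreal (norm (cmod (h y) powr r)) \<partial>bessel_measure \<nu>) < \<infinity>"
    by (auto intro: le_less_trans)
  then have I: "integrable (bessel_measure \<nu>) (\<lambda>y. cmod (h y) powr r)"
    by (intro integrableI_bounded) measurable
  then show "h \<in> bessel_Lp \<nu> (ennreal r)"
    using h \<open>0 < r\<close> by (simp add: bessel_Lp_def)
  have "ennreal (LINT y|bessel_measure \<nu>. cmod (h y) powr r) \<le> ennreal (D powr r)"
    using * I by (subst nn_integral_eq_integral[symmetric]) auto
  then have "(LINT y|bessel_measure \<nu>. cmod (h y) powr r) \<le> D powr r"
    by (subst (asm) ennreal_le_iff) auto
  then have "bessel_norm \<nu> (ennreal r) h \<le> (D powr r) powr (1 / r)"
    using \<open>0 < r\<close> unfolding bessel_norm_def by (auto intro!: powr_mono2)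
  then show "bessel_norm \<nu> (ennreal r) h \<le> D"
    using \<open>0 < r\<close> \<open>0 \<le> D\<close> by (simp add: powr_powr)
qed

text \<open>
  The essential bound becomes a bound everywhere once the representative is set to zero where it is
  exceeded.
\<close>

lemma bessel_Lp_infinityD:
  assumes f: "f \<in> bessel_Lp \<nu> \<infinity>"
  obtains f' where "f' \<in> borel_measurable borel" "AE y in radial_measure \<nu>. f y = f' y"
    "\<And>y. cmod (f' y) \<le> bessel_norm \<nu> \<infinity> f" "0 \<le> bessel_norm \<nu> \<infinity> f"
proof -
  define e where "e = esssup (bessel_measure \<nu>) (\<lambda>y. ereal (cmod (f y)))"
  define C where "C = bessel_norm \<nu> \<infinity> f"
  have f_meas [measurable]: "f \<in> borel_measurable (bessel_measure \<nu>)" and "e < \<infinity>"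
    using f by (auto simp: bessel_Lp_def e_def)
  have C_e: "C = real_of_ereal e" by (simp add: C_def bessel_norm_def e_def)
  have ae_e: "AE y in bessel_measure \<nu>. ereal (cmod (f y)) \<le> e"
    unfolding e_def by (rule esssup_AE)
  \<comment> \<open>A negative essential supremum forces the measure to be zero, hence the essential
    supremum to be minus infinity, which the conversion to a real number sends to 0.\<close>
  have "0 \<le> C"
  proof (rule ccontr)
    assume "\<not> 0 \<le> C"
    then have "e < 0" "e \<noteq> - \<infinity>" unfolding C_e by (cases e; auto)+
    have "AE y in bessel_measure \<nu>. ereal (cmod (f y)) \<le> - \<infinity>"
      using ae_e
    proof eventually_elim
      case (elim y)
      have "0 \<le> ereal (cmod (f y))" by simp
      then show ?case using elim \<open>e < 0\<close> by order
    qed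
    then have "e \<le> - \<infinity>" unfolding e_def by (intro esssup_I) measurable
    then show False using \<open>e \<noteq> - \<infinity>\<close> by simp
  qed
  have ae_C: "AE y in radial_measure \<nu>. cmod (f y) \<le> C"
    using ae_e \<open>e < \<infinity>\<close> unfolding C_e AE_bessel_measure_iff by (cases e) auto
  obtain g where [measurable]: "g \<in> borel_measurable borel" and g: "AE y in radial_measure \<nu>. f y = g y"
    using ex_borel_representative[OF f_meas] .
  show ?thesis
  proof
    show "(\<lambda>y. if cmod (g y) \<le> C then g y else 0) \<in> borel_measurable borel" by measurable
    show "AE y in radial_measure \<nu>. f y = (if cmod (g y) \<le> C then g y else 0)"
      using g ae_C by eventually_elim auto
  qed (use \<open>0 \<le> C\<close> in \<open>auto simp: C_def\<close>)
qed

lemma bessel_Lp_infinityI: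
  assumes h [measurable]: "h \<in> borel_measurable (bessel_measure \<nu>)"
    and le: "AE y in radial_measure \<nu>. cmod (h y) \<le> D" and "0 \<le> D"
  shows "h \<in> bessel_Lp \<nu> \<infinity>" and "bessel_norm \<nu> \<infinity> h \<le> D"
proof -
  have e: "esssup (bessel_measure \<nu>) (\<lambda>y. ereal (cmod (h y))) \<le> ereal D"
    using le by (intro esssup_I) (auto simp: AE_bessel_measure_iff)
  then show "h \<in> bessel_Lp \<nu> \<infinity>"
    using h by (auto simp: bessel_Lp_def intro: le_less_trans)
  show "bessel_norm \<nu> \<infinity> h \<le> D"
    using e \<open>0 \<le> D\<close> unfolding bessel_norm_def
    by (cases "esssup (bessel_measure \<nu>) (\<lambda>y. ereal (cmod (h y)))") auto
qed

text \<open>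
  The translation is an expectation with respect to the angular measure; the normalizing constant
  of the translation is part of the density.
\<close>

lemma
  fixes \<nu> x y :: real and f :: "real \<Rightarrow> complex"
  assumes \<nu>: "\<nu> > - 1 / 2" and [measurable]: "f' \<in> borel_measurable borel"
    and ae: "AE \<theta> in angular_measure \<nu>. f (third_side x y \<theta>) = f' (third_side x y \<theta>)"
  shows bessel_translation_exists_iff:
      "bessel_translation_exists \<nu> x f y \<longleftrightarrow> integrable (angular_measure \<nu>) (\<lambda>\<theta>. f' (third_side x y \<theta>))"
    and bessel_translation_eq:
      "bessel_translation \<nu> x f y = (LINT \<theta>|angular_measure \<nu>. f' (third_side x y \<theta>))"
proof -
  define c where "c = Gamma (\<nu> + 1) / (sqrt pi * Gamma (\<nu> + 1 / 2))"
  have c: "c > 0" unfolding c_def by (rule angular_const_pos[OF \<nu>])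
  define u where "u \<theta> = indicator {0..pi} \<theta> *\<^sub>R (f (third_side x y \<theta>) * complex_of_real (sin \<theta> powr (2 * \<nu>)))" for \<theta>
  \<comment> \<open>The two integrands differ at most at the endpoints and on the exceptional set, so
    the one built from the original function is Lebesgue measurable by completeness.\<close>
  define w where "w \<theta> = inverse c *\<^sub>R (angular_density \<nu> \<theta> *\<^sub>R f' (third_side x y \<theta>))" for \<theta>
  have [measurable]: "w \<in> borel_measurable borel" unfolding w_def by measurable
  then have w_leb: "w \<in> borel_measurable lebesgue" by (intro measurable_completion) simp
  have "AE \<theta> in lborel. 0 < ennreal (angular_density \<nu> \<theta>) \<longrightarrow> f (third_side x y \<theta>) = f' (third_side x y \<theta>)"
    using ae unfolding angular_measure_def by (subst (asm) AE_density) auto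
  moreover have "AE \<theta> in lborel. \<theta> \<noteq> (0 :: real)" "AE \<theta> in lborel. \<theta> \<noteq> pi"
    by (rule AE_lborel_singleton)+
  ultimately have "AE \<theta> in lborel. w \<theta> = u \<theta>"
  proof eventually_elim
    case (elim \<theta>)
    show ?case
    proof (cases "\<theta> \<in> {0<..<pi}")
      case True
      then have s: "sin \<theta> > 0" by (intro sin_gt_zero) auto
      have d: "angular_density \<nu> \<theta> = c * sin \<theta> powr (2 * \<nu>)"
        using True by (simp add: angular_density_def c_def)
      then have "f (third_side x y \<theta>) = f' (third_side x y \<theta>)"
        using elim c s by simp
      then show ?thesis
        using True c by (simp add: u_def w_def d scaleR_conv_of_real)
    qed (use elim in \<open>auto simp: u_def w_def angular_density_def split: split_indicator\<close>)
  qed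
  then have wu: "AE \<theta> in lebesgue. w \<theta> = u \<theta>" by (rule AE_completion)
  then have u_leb: "u \<in> borel_measurable lebesgue" by (rule borel_measurable_AE[OF w_leb])
  have "bessel_translation_exists \<nu> x f y \<longleftrightarrow> integrable lebesgue u"
    by (simp add: bessel_translation_exists_def set_integrable_def u_def[abs_def] third_side_def)
  also have "\<dots> \<longleftrightarrow> integrable lebesgue w"
    using wu by (intro integrable_cong_AE u_leb w_leb) auto
  also have "\<dots> \<longleftrightarrow> integrable lborel w"
    by (rule integrable_completion) simp
  also have "\<dots> \<longleftrightarrow> integrable lborel (\<lambda>\<theta>. angular_density \<nu> \<theta> *\<^sub>R f' (third_side x y \<theta>))"
  proof
    assume "integrable lborel w"
    then have "integrable lborel (\<lambda>\<theta>. c *\<^sub>R w \<theta>)" by (intro integrable_scaleR_right)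
    moreover have "c *\<^sub>R w \<theta> = angular_density \<nu> \<theta> *\<^sub>R f' (third_side x y \<theta>)" for \<theta>
      unfolding w_def scaleR_scaleR mult.assoc[symmetric] using c by simp
    ultimately show "integrable lborel (\<lambda>\<theta>. angular_density \<nu> \<theta> *\<^sub>R f' (third_side x y \<theta>))"
      by simp
  qed (unfold w_def, rule integrable_scaleR_right)
  also have "\<dots> \<longleftrightarrow> integrable (angular_measure \<nu>) (\<lambda>\<theta>. f' (third_side x y \<theta>))"
    unfolding angular_measure_def by (subst integrable_density) (auto simp: angular_density_nonneg[OF \<nu>])
  finally show "bessel_translation_exists \<nu> x f y \<longleftrightarrow>
      integrable (angular_measure \<nu>) (\<lambda>\<theta>. f' (third_side x y \<theta>))" .
  have "bessel_translation \<nu> x f y = complex_of_real c * (LINT \<theta>|lebesgue. u \<theta>)"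
    by (simp add: bessel_translation_def set_lebesgue_integral_def u_def third_side_def c_def)
  also have "(LINT \<theta>|lebesgue. u \<theta>) = (LINT \<theta>|lebesgue. w \<theta>)"
    using wu by (intro integral_cong_AE u_leb w_leb) auto
  also have "\<dots> = (LINT \<theta>|lborel. w \<theta>)"
    by (rule integral_completion) simp
  also have "\<dots> = inverse c *\<^sub>R (LINT \<theta>|lborel. angular_density \<nu> \<theta> *\<^sub>R f' (third_side x y \<theta>))"
    unfolding w_def by (rule integral_scaleR_right)
  also have "(LINT \<theta>|lborel. angular_density \<nu> \<theta> *\<^sub>R f' (third_side x y \<theta>)) =
      (LINT \<theta>|angular_measure \<nu>. f' (third_side x y \<theta>))"
    unfolding angular_measure_def by (subst integral_density) (auto simp: angular_density_nonneg[OF \<nu>])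
  finally show "bessel_translation \<nu> x f y = (LINT \<theta>|angular_measure \<nu>. f' (third_side x y \<theta>))"
    using c by (simp add: scaleR_conv_of_real)
qed

section \<open>Young's inequality for the Bessel convolution\<close>

text \<open>
  The ordinary Bessel convolution is what remains of the generalized one after chirps are removed.
\<close>

definition bessel_convolution :: "real \<Rightarrow> (real \<Rightarrow> complex) \<Rightarrow> (real \<Rightarrow> complex) \<Rightarrow> real \<Rightarrow> complex" where
  "bessel_convolution \<nu> f g x = (LINT y|bessel_measure \<nu>. bessel_translation \<nu> x f y * g y)"

definition bessel_convolution_exists ::
    "real \<Rightarrow> (real \<Rightarrow> complex) \<Rightarrow> (real \<Rightarrow> complex) \<Rightarrow> real \<Rightarrow> bool" where
  "bessel_convolution_exists \<nu> f g x \<longleftrightarrow>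
    (AE y in bessel_measure \<nu>. bessel_translation_exists \<nu> x f y) \<and>
    integrable (bessel_measure \<nu>) (\<lambda>y. bessel_translation \<nu> x f y * g y)"

definition angular_mean :: "real \<Rightarrow> (real \<Rightarrow> complex) \<Rightarrow> real \<Rightarrow> real \<Rightarrow> complex" where
  "angular_mean \<nu> f x y = (LINT \<theta>|angular_measure \<nu>. f (third_side x y \<theta>))"

text \<open>
  Finiteness of the convolution of the moduli says nothing about the translation of $f$ where $g$
  vanishes, so its existence is shown separately: $F \le 1 + F^p$, and the translation of $F^p$ has
  a finite integral.
\<close>

lemma AE_nn_integral_translation_finite:
  assumes \<nu>: "\<nu> > - 1 / 2" and [measurable]: "F \<in> borel_measurable borel"
    and nn: "\<And>t. 0 \<le> F t" and "1 \<le> p"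
    and fin: "(\<integral>\<^sup>+y. ennreal (F y powr p) \<partial>radial_measure \<nu>) < \<infinity>"
  shows "AE y in radial_measure \<nu>. (\<integral>\<^sup>+\<theta>. ennreal (F (third_side x y \<theta>)) \<partial>angular_measure \<nu>) < \<infinity>"
proof -
  interpret angular: prob_space "angular_measure \<nu>"
    by (rule prob_space_angular_measure[OF \<nu>])
  have "(\<integral>\<^sup>+y. \<integral>\<^sup>+\<theta>. ennreal (F (third_side x y \<theta>) powr p) \<partial>angular_measure \<nu> \<partial>radial_measure \<nu>) \<noteq> \<infinity>"
    using fin by (subst nn_integral_bessel_translation[OF \<nu>]) auto
  then have "AE y in radial_measure \<nu>.
      (\<integral>\<^sup>+\<theta>. ennreal (F (third_side x y \<theta>) powr p) \<partial>angular_measure \<nu>) \<noteq> \<infinity>"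
    by (intro nn_integral_PInf_AE) auto
  then show ?thesis
  proof eventually_elim
    case (elim y)
    have le: "t \<le> 1 + t powr p" if "0 \<le> t" for t
    proof (cases "t \<le> 1")
      case False
      then have "t powr 1 \<le> t powr p" using \<open>1 \<le> p\<close> by (intro powr_mono) auto
      then show ?thesis using False by simp
    qed (simp add: add_increasing2)
    have "(\<integral>\<^sup>+\<theta>. ennreal (F (third_side x y \<theta>)) \<partial>angular_measure \<nu>) \<le>
        (\<integral>\<^sup>+\<theta>. 1 + ennreal (F (third_side x y \<theta>) powr p) \<partial>angular_measure \<nu>)"
    proof (intro nn_integral_mono)
      fix \<theta>
      have "ennreal (F (third_side x y \<theta>)) \<le> ennreal (1 + F (third_side x y \<theta>) powr p)"
        by (intro ennreal_leI le nn)
      then show "ennreal (F (third_side x y \<theta>)) \<le> 1 + ennreal (F (third_side x y \<theta>) powr p)"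
        by (simp add: ennreal_plus)
    qed
    also have "\<dots> = 1 + (\<integral>\<^sup>+\<theta>. ennreal (F (third_side x y \<theta>) powr p) \<partial>angular_measure \<nu>)"
      using angular.emeasure_space_1 by (subst nn_integral_add) auto
    also have "\<dots> < \<infinity>" using elim by (simp add: less_top)
    finally show ?case .
  qed
qed

context
  fixes \<nu> :: real and f g f' g' :: "real \<Rightarrow> complex"
  assumes \<nu>: "\<nu> > - 1 / 2"
    and meas [measurable]: "f' \<in> borel_measurable borel" "g' \<in> borel_measurable borel"
    and ae: "AE y in radial_measure \<nu>. f y = f' y" "AE y in radial_measure \<nu>. g y = g' y"
begin

interpretation angular: prob_space "angular_measure \<nu>"
  by (rule prob_space_angular_measure[OF \<nu>])

lemma measurable_angular_mean [measurable (raw)]: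
  assumes [measurable]: "u \<in> borel_measurable M" "v \<in> borel_measurable M"
  shows "(\<lambda>t. angular_mean \<nu> f' (u t) (v t)) \<in> borel_measurable M"
  unfolding angular_mean_def by measurable

lemma AE_translation_eq:
  "AE y in radial_measure \<nu>. bessel_translation \<nu> x f y * g y = angular_mean \<nu> f' x y * g' y"
  using AE_bessel_translation[OF \<nu> ae(1), of x] ae(2)
proof eventually_elim
  case (elim y)
  then show ?case using bessel_translation_eq[OF \<nu> meas(1) elim(1)] by (simp add: angular_mean_def)
qed

lemma bessel_convolution_eq:
  "bessel_convolution \<nu> f g x = (LINT y|radial_measure \<nu>. angular_mean \<nu> f' x y * g' y)"
  unfolding bessel_convolution_def by (rule integral_bessel_measure[OF _ AE_translation_eq]) measurable

lemma borel_measurable_bessel_convolution: "bessel_convolution \<nu> f g \<in> borel_measurable borel"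
  unfolding bessel_convolution_eq[abs_def] by measurable

text \<open>
  The triangle inequality for the inner integral. When the inner integral does not exist it has the
  value $0$, and the bound holds trivially.
\<close>

lemma nn_integral_angular_mean_le:
  "(\<integral>\<^sup>+y. ennreal (cmod (angular_mean \<nu> f' x y * g' y)) \<partial>radial_measure \<nu>) \<le>
    nn_bessel_convolution \<nu> (\<lambda>t. cmod (f' t)) (\<lambda>t. cmod (g' t)) x"
  unfolding nn_bessel_convolution_def
proof (intro nn_integral_mono)
  fix y
  have "ennreal (cmod (angular_mean \<nu> f' x y)) \<le> (\<integral>\<^sup>+\<theta>. ennreal (cmod (f' (third_side x y \<theta>))) \<partial>angular_measure \<nu>)"
  proof (cases "integrable (angular_measure \<nu>) (\<lambda>\<theta>. f' (third_side x y \<theta>))")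
    case True
    then show ?thesis unfolding angular_mean_def by (rule integral_norm_bound_ennreal)
  qed (simp add: angular_mean_def not_integrable_integral_eq)
  then have "ennreal (cmod (angular_mean \<nu> f' x y)) * ennreal (cmod (g' y)) \<le>
      (\<integral>\<^sup>+\<theta>. ennreal (cmod (f' (third_side x y \<theta>))) \<partial>angular_measure \<nu>) * ennreal (cmod (g' y))"
    by (rule mult_right_mono) simp
  then show "ennreal (cmod (angular_mean \<nu> f' x y * g' y)) \<le>
      (\<integral>\<^sup>+\<theta>. ennreal (cmod (f' (third_side x y \<theta>)) * cmod (g' y)) \<partial>angular_measure \<nu>)"
    by (simp add: norm_mult ennreal_mult' nn_integral_multc)
qed

lemma bessel_convolution_exists_if_finite:
  assumes fin: "nn_bessel_convolution \<nu> (\<lambda>t. cmod (f' t)) (\<lambda>t. cmod (g' t)) x < \<infinity>"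
    and mean_fin: "AE y in radial_measure \<nu>.
      (\<integral>\<^sup>+\<theta>. ennreal (cmod (f' (third_side x y \<theta>))) \<partial>angular_measure \<nu>) < \<infinity>"
  shows "bessel_convolution_exists \<nu> f g x"
  unfolding bessel_convolution_exists_def
proof
  show "AE y in bessel_measure \<nu>. bessel_translation_exists \<nu> x f y"
    unfolding AE_bessel_measure_iff using AE_bessel_translation[OF \<nu> ae(1), of x] mean_fin
  proof eventually_elim
    case (elim y)
    then show ?case
      using bessel_translation_exists_iff[OF \<nu> meas(1) elim(1)] by (simp add: integrable_iff_bounded)
  qed
  have "integrable (radial_measure \<nu>) (\<lambda>y. angular_mean \<nu> f' x y * g' y)"
    using le_less_trans[OF nn_integral_angular_mean_le fin] by (intro integrableI_bounded) auto
  then show "integrable (bessel_measure \<nu>) (\<lambda>y. bessel_translation \<nu> x f y * g y)"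
    by (subst integrable_bessel_measure_iff[OF _ AE_translation_eq]) auto
qed

lemma cmod_bessel_convolution_le:
  "ennreal (cmod (bessel_convolution \<nu> f g x)) \<le>
    nn_bessel_convolution \<nu> (\<lambda>t. cmod (f' t)) (\<lambda>t. cmod (g' t)) x"
proof (cases "integrable (radial_measure \<nu>) (\<lambda>y. angular_mean \<nu> f' x y * g' y)")
  case True
  then show ?thesis
    unfolding bessel_convolution_eq
    by (intro order_trans[OF integral_norm_bound_ennreal nn_integral_angular_mean_le])
qed (simp add: bessel_convolution_eq not_integrable_integral_eq)

end

text \<open>
  An infinite $p$ or $q$ forces the other exponent to be $1$ and $r$ to be infinite; there
  the bound is immediate from the total mass of the angular measure or from invariance. The other
  cases are $r = \infty$ with conjugate finite exponents, and three finite exponents.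
\<close>

theorem bessel_convolution_Young:
  assumes \<nu>: "\<nu> > - 1 / 2"
    and pqr: "1 \<le> p" "1 \<le> q" "1 \<le> r" "inverse p + inverse q = inverse r + 1"
    and f: "f \<in> bessel_Lp \<nu> p" and g: "g \<in> bessel_Lp \<nu> q"
  shows "AE x in bessel_measure \<nu>. bessel_convolution_exists \<nu> f g x"
    and "bessel_convolution \<nu> f g \<in> bessel_Lp \<nu> r"
    and "bessel_norm \<nu> r (bessel_convolution \<nu> f g) \<le> bessel_norm \<nu> p f * bessel_norm \<nu> q g"
proof -
  let ?K = "\<lambda>f' g'. nn_bessel_convolution \<nu> (\<lambda>t. cmod (f' t)) (\<lambda>t. cmod (g' t))"
  let ?goal = "(AE x in bessel_measure \<nu>. bessel_convolution_exists \<nu> f g x) \<and>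
    bessel_convolution \<nu> f g \<in> bessel_Lp \<nu> r \<and>
    bessel_norm \<nu> r (bessel_convolution \<nu> f g) \<le> bessel_norm \<nu> p f * bessel_norm \<nu> q g"
  have f_meas: "f \<in> borel_measurable (bessel_measure \<nu>)" and g_meas: "g \<in> borel_measurable (bessel_measure \<nu>)"
    using f g by (auto simp: bessel_Lp_def)
  have finite_exponent: "\<exists>t. 1 \<le> t \<and> s = ennreal t" if "1 \<le> s" "s \<noteq> \<infinity>" for s :: ennreal
    using that by (cases s) (auto simp: ennreal_ge_1)
  have inv: "inverse (ennreal t) = ennreal (1 / t)" if "1 \<le> t" for t
    using that by (simp add: inverse_ennreal inverse_eq_divide)
  have one_plus: "ennreal t + 1 = ennreal (t + 1)" if "0 \<le> t" for t
    using that by (simp add: ennreal_plus)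
  \<comment> \<open>For infinite \<open>r\<close> a uniform bound on the convolution of the moduli suffices.\<close>
  have bounded: ?goal
    if "f' \<in> borel_measurable borel" "g' \<in> borel_measurable borel"
      "AE y in radial_measure \<nu>. f y = f' y" "AE y in radial_measure \<nu>. g y = g' y"
      and mean_fin: "\<And>x. AE y in radial_measure \<nu>.
        (\<integral>\<^sup>+\<theta>. ennreal (cmod (f' (third_side x y \<theta>))) \<partial>angular_measure \<nu>) < \<infinity>"
      and le: "\<And>x. ?K f' g' x \<le> ennreal (bessel_norm \<nu> p f * bessel_norm \<nu> q g)"
      and nonneg: "0 \<le> bessel_norm \<nu> p f" "0 \<le> bessel_norm \<nu> q g" and "r = \<infinity>" for f' g'
  proof -
    note ctx = \<nu> that(1-4)
    have "?K f' g' x < \<infinity>" for x using le[of x] by (rule le_less_trans) simp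
    then have ex: "bessel_convolution_exists \<nu> f g x" for x
      using mean_fin by (rule bessel_convolution_exists_if_finite[OF ctx])
    have "cmod (bessel_convolution \<nu> f g x) \<le> bessel_norm \<nu> p f * bessel_norm \<nu> q g" for x
      using order_trans[OF cmod_bessel_convolution_le[OF ctx] le[of x]] nonneg
      by (subst (asm) ennreal_le_iff) auto
    then show ?thesis
      using bessel_Lp_infinityI[OF borel_measurable_bessel_measureI[OF borel_measurable_bessel_convolution[OF ctx]],
          of "bessel_norm \<nu> p f * bessel_norm \<nu> q g"] ex nonneg \<open>r = \<infinity>\<close> by auto
  qed
  have ?goal
  proof (cases "p = \<infinity>")
    case True
    have "q \<noteq> \<infinity>" using pqr(4) True by auto
    then obtain b where b: "1 \<le> b" "q = ennreal b" using finite_exponent pqr(2) by blast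
    have "r = \<infinity>"
    proof (rule ccontr)
      assume "r \<noteq> \<infinity>"
      then obtain c where c: "1 \<le> c" "r = ennreal c" using finite_exponent pqr(3) by blast
      then have "ennreal (1 / b) = ennreal (1 / c + 1)"
        using pqr(4) True b by (simp add: inv one_plus del: ennreal_plus)
      then have "1 / b = 1 / c + 1" using b c by (subst (asm) ennreal_inj) auto
      moreover have "1 / b \<le> 1" "0 < 1 / c" using b c by auto
      ultimately show False by linarith
    qed
    have "ennreal (1 / b) = ennreal 1" using pqr(4) True b \<open>r = \<infinity>\<close> by (simp add: inv)
    then have "b = 1" using b by (subst (asm) ennreal_inj) auto
    obtain f' where f': "f' \<in> borel_measurable borel" "AE y in radial_measure \<nu>. f y = f' y"
      and f'_le: "\<And>y. cmod (f' y) \<le> bessel_norm \<nu> p f" and C: "0 \<le> bessel_norm \<nu> p f"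
      using bessel_Lp_infinityD[of f \<nu>] f True by metis
    obtain g' where g': "g' \<in> borel_measurable borel" "AE y in radial_measure \<nu>. g y = g' y"
      using ex_borel_representative[OF g_meas] .
    obtain Q where Q: "0 \<le> Q" "(\<integral>\<^sup>+y. ennreal (cmod (g' y) powr b) \<partial>radial_measure \<nu>) = ennreal Q"
      "bessel_norm \<nu> (ennreal b) g = Q powr (1 / b)"
      using bessel_Lp_finiteD[OF g[unfolded b] _ g'] b by auto
    note [measurable] = f'(1) g'(1)
    show ?thesis
    proof (rule bounded[OF f'(1) g'(1) f'(2) g'(2)])
      fix x
      have "(\<integral>\<^sup>+\<theta>. ennreal (cmod (f' (third_side x y \<theta>))) \<partial>angular_measure \<nu>) \<le>
          (\<integral>\<^sup>+\<theta>. ennreal (bessel_norm \<nu> p f) \<partial>angular_measure \<nu>)" for y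
        by (intro nn_integral_mono ennreal_leI f'_le)
      also have "(\<integral>\<^sup>+\<theta>. ennreal (bessel_norm \<nu> p f) \<partial>angular_measure \<nu>) < \<infinity>"
        using prob_space.emeasure_space_1[OF prob_space_angular_measure[OF \<nu>]] by simp
      finally show "AE y in radial_measure \<nu>.
          (\<integral>\<^sup>+\<theta>. ennreal (cmod (f' (third_side x y \<theta>))) \<partial>angular_measure \<nu>) < \<infinity>"
        by simp
      show "?K f' g' x \<le> ennreal (bessel_norm \<nu> p f * bessel_norm \<nu> q g)"
        using Q b \<open>b = 1\<close> f'_le C
        by (intro nn_bessel_convolution_le_bounded_left[OF \<nu>]) auto
    qed (use C Q b \<open>r = \<infinity>\<close> in auto)
  next
    case False
    then obtain a where a: "1 \<le> a" "p = ennreal a" using finite_exponent pqr(1) by blast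
    obtain f' where f': "f' \<in> borel_measurable borel" "AE y in radial_measure \<nu>. f y = f' y"
      using ex_borel_representative[OF f_meas] .
    obtain P where P: "0 \<le> P" "(\<integral>\<^sup>+y. ennreal (cmod (f' y) powr a) \<partial>radial_measure \<nu>) = ennreal P"
      "bessel_norm \<nu> (ennreal a) f = P powr (1 / a)"
      using bessel_Lp_finiteD[OF f[unfolded a] _ f'] a by auto
    note [measurable] = f'(1)
    have mean_fin: "AE y in radial_measure \<nu>.
        (\<integral>\<^sup>+\<theta>. ennreal (cmod (f' (third_side x y \<theta>))) \<partial>angular_measure \<nu>) < \<infinity>" for x
      using a P by (intro AE_nn_integral_translation_finite[OF \<nu>, where p = a]) auto
    show ?thesis
    proof (cases "q = \<infinity>")
      case True
      have "r = \<infinity>"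
      proof (rule ccontr)
        assume "r \<noteq> \<infinity>"
        then obtain c where c: "1 \<le> c" "r = ennreal c" using finite_exponent pqr(3) by blast
        then have "ennreal (1 / a) = ennreal (1 / c + 1)"
          using pqr(4) True a by (simp add: inv one_plus del: ennreal_plus)
        then have "1 / a = 1 / c + 1" using a c by (subst (asm) ennreal_inj) auto
        moreover have "1 / a \<le> 1" "0 < 1 / c" using a c by auto
        ultimately show False by linarith
      qed
      have "ennreal (1 / a) = ennreal 1" using pqr(4) True a \<open>r = \<infinity>\<close> by (simp add: inv)
      then have "a = 1" using a by (subst (asm) ennreal_inj) auto
      obtain g' where g': "g' \<in> borel_measurable borel" "AE y in radial_measure \<nu>. g y = g' y"
        and g'_le: "\<And>y. cmod (g' y) \<le> bessel_norm \<nu> q g" and C: "0 \<le> bessel_norm \<nu> q g"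
        using bessel_Lp_infinityD[of g \<nu>] g True by metis
      note [measurable] = g'(1)
      show ?thesis
      proof (rule bounded[OF f'(1) g'(1) f'(2) g'(2) mean_fin])
        show "?K f' g' x \<le> ennreal (bessel_norm \<nu> p f * bessel_norm \<nu> q g)" for x
          using P a \<open>a = 1\<close> g'_le C
          by (intro nn_bessel_convolution_le_bounded_right[OF \<nu>]) auto
      qed (use C P a \<open>r = \<infinity>\<close> in auto)
    next
      case False
      then obtain b where b: "1 \<le> b" "q = ennreal b" using finite_exponent pqr(2) by blast
      obtain g' where g': "g' \<in> borel_measurable borel" "AE y in radial_measure \<nu>. g y = g' y"
        using ex_borel_representative[OF g_meas] .
      obtain Q where Q: "0 \<le> Q" "(\<integral>\<^sup>+y. ennreal (cmod (g' y) powr b) \<partial>radial_measure \<nu>) = ennreal Q"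
        "bessel_norm \<nu> (ennreal b) g = Q powr (1 / b)"
        using bessel_Lp_finiteD[OF g[unfolded b] _ g'] b by auto
      note [measurable] = g'(1)
      have sum: "inverse p + inverse q = ennreal (1 / a + 1 / b)"
        using a b by (simp add: inv ennreal_plus)
      show ?thesis
      proof (cases "r = \<infinity>")
        case True
        have "ennreal (1 / a + 1 / b) = ennreal 1"
          using pqr(4) sum True by simp
        then have "1 / a + 1 / b = 1" using a b by (subst (asm) ennreal_inj) auto
        show ?thesis
        proof (rule bounded[OF f'(1) g'(1) f'(2) g'(2) mean_fin])
          show "?K f' g' x \<le> ennreal (bessel_norm \<nu> p f * bessel_norm \<nu> q g)" for x
            unfolding a(2) b(2) P(3) Q(3)
            by (rule nn_bessel_convolution_le_conjugate[OF \<nu>])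
              (use a b P Q \<open>1 / a + 1 / b = 1\<close> in auto)
        qed (use P Q a b True in auto)
      next
        case False
        then obtain c where c: "1 \<le> c" "r = ennreal c" using finite_exponent pqr(3) by blast
        have "ennreal (1 / a + 1 / b) = ennreal (1 / c + 1)"
          using pqr(4) sum c by (simp add: inv one_plus del: ennreal_plus)
        then have abc: "1 / a + 1 / b = 1 / c + 1" using a b c by (subst (asm) ennreal_inj) auto
        note ctx = \<nu> f'(1) g'(1) f'(2) g'(2)
        let ?D = "P powr (1 / a) * Q powr (1 / b)"
        have fin: "AE x in radial_measure \<nu>. ?K f' g' x < \<infinity>"
          by (rule nn_bessel_convolution_Young(1)[OF \<nu> _ _ _ _ a(1) b(1) c(1) abc P(2,1) Q(2,1)]) auto
        have int: "(\<integral>\<^sup>+x. ennreal (enn2real (?K f' g' x) powr c) \<partial>radial_measure \<nu>) \<le> ennreal (?D powr c)"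
          by (rule nn_bessel_convolution_Young(2)[OF \<nu> _ _ _ _ a(1) b(1) c(1) abc P(2,1) Q(2,1)]) auto
        have ex: "AE x in bessel_measure \<nu>. bessel_convolution_exists \<nu> f g x"
          unfolding AE_bessel_measure_iff using fin
          by eventually_elim (rule bessel_convolution_exists_if_finite[OF ctx _ mean_fin])
        have le: "AE x in radial_measure \<nu>. cmod (bessel_convolution \<nu> f g x) \<le> enn2real (?K f' g' x)"
          using fin
        proof eventually_elim
          case (elim x)
          have "ennreal (cmod (bessel_convolution \<nu> f g x)) \<le> ?K f' g' x"
            by (rule cmod_bessel_convolution_le[OF ctx])
          also have "\<dots> = ennreal (enn2real (?K f' g' x))"
            using elim by (simp add: less_top)
          finally show ?case by (subst (asm) ennreal_le_iff) auto
        qed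
        have K_meas: "(\<lambda>x. enn2real (?K f' g' x)) \<in> borel_measurable borel"
          by (intro measurable_compose[OF measurable_nn_bessel_convolution[OF \<nu>] borel_measurable_enn2real]) auto
        note Lp = bessel_Lp_finiteI[OF
            borel_measurable_bessel_measureI[OF borel_measurable_bessel_convolution[OF ctx]] le K_meas int]
        show ?thesis
          using ex Lp c unfolding c(2) a(2) b(2) P(3) Q(3) by auto
      qed
    qed
  qed
  then show "AE x in bessel_measure \<nu>. bessel_convolution_exists \<nu> f g x"
    and "bessel_convolution \<nu> f g \<in> bessel_Lp \<nu> r"
    and "bessel_norm \<nu> r (bessel_convolution \<nu> f g) \<le> bessel_norm \<nu> p f * bessel_norm \<nu> q g"
    by blast+
qed

section \<open>Chirps and the generalized convolution\<close>

definition chirp :: "real \<Rightarrow> (real \<Rightarrow> complex) \<Rightarrow> real \<Rightarrow> complex" where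
  "chirp k f s = cis (- (1 / 2 * k * s\<^sup>2)) * f s"

lemma chirp_in_bessel_Lp: "f \<in> bessel_Lp \<nu> p \<Longrightarrow> chirp k f \<in> bessel_Lp \<nu> p"
proof -
  assume f: "f \<in> bessel_Lp \<nu> p"
  have "(\<lambda>s. cis (- (1 / 2 * k * s\<^sup>2))) \<in> borel_measurable (bessel_measure \<nu>)"
    by (intro borel_measurable_bessel_measureI borel_measurable_continuous_onI) (auto intro!: continuous_intros)
  then have "chirp k f \<in> borel_measurable (bessel_measure \<nu>)"
    using f unfolding chirp_def[abs_def] bessel_Lp_def by auto
  then show ?thesis
    using f by (auto simp: bessel_Lp_def chirp_def norm_mult split: if_splits)
qed

lemma bessel_norm_chirp: "bessel_norm \<nu> p (chirp k f) = bessel_norm \<nu> p f"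
  by (simp add: bessel_norm_def chirp_def norm_mult)

text \<open>
  Of the phase $\frac k2 (x^2 + y^2) - k y^2$ the part $\frac k2 x^2$ leaves the integral, and
  the rest, $-\frac k2 y^2$, is the chirp for $g$.
\<close>

lemma gen_integrand_eq:
  assumes "k = m $ 2 $ 2 / m $ 1 $ 2"
  shows "gen_translation \<nu> m x f y * (cis (- (m $ 2 $ 2 / m $ 1 $ 2 * y\<^sup>2)) * g y) =
    cis (1 / 2 * k * x\<^sup>2) * (bessel_translation \<nu> x (chirp k f) y * chirp k g y)"
proof -
  have "1 / 2 * k * (x\<^sup>2 + y\<^sup>2) + - (k * y\<^sup>2) = 1 / 2 * k * x\<^sup>2 + - (1 / 2 * k * y\<^sup>2)"
    by (simp add: field_simps)
  then have "cis (1 / 2 * k * (x\<^sup>2 + y\<^sup>2)) * cis (- (k * y\<^sup>2)) = cis (1 / 2 * k * x\<^sup>2) * cis (- (1 / 2 * k * y\<^sup>2))"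
    by (simp only: cis_mult)
  moreover have "(A * t) * (B * u) = C * (t * (D * u))" if "A * B = C * D" for A B C D t u :: complex
    using arg_cong[OF that, of "\<lambda>z. z * (t * u)"] by (simp only: ac_simps)
  ultimately show ?thesis
    unfolding gen_translation_def assms[symmetric] chirp_def[abs_def] by blast
qed

lemma gen_convolution_eq:
  assumes "k = m $ 2 $ 2 / m $ 1 $ 2"
  shows "gen_convolution \<nu> m f g x = cis (1 / 2 * k * x\<^sup>2) * bessel_convolution \<nu> (chirp k f) (chirp k g) x"
  unfolding gen_convolution_def bessel_convolution_def gen_integrand_eq[OF assms] by simp

lemma gen_convolution_exists_if:
  assumes "k = m $ 2 $ 2 / m $ 1 $ 2" "bessel_convolution_exists \<nu> (chirp k f) (chirp k g) x"
  shows "gen_convolution_exists \<nu> m f g x"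
  unfolding gen_convolution_exists_def
proof
  show "AE y in bessel_measure \<nu>. gen_translation_exists \<nu> m x f y"
    using assms unfolding bessel_convolution_exists_def gen_translation_exists_def chirp_def[abs_def]
    by simp
  show "integrable (bessel_measure \<nu>)
      (\<lambda>y. gen_translation \<nu> m x f y * (cis (- (m $ 2 $ 2 / m $ 1 $ 2 * y\<^sup>2)) * g y))"
    using assms(2) unfolding gen_integrand_eq[OF assms(1)] bessel_convolution_exists_def
    by (intro integrable_mult_right) auto
qed

theorem proposition3p5:
  fixes \<nu> :: real and m :: "real^2^2" and p q r :: ennreal and f g :: "real \<Rightarrow> complex"
  assumes "\<nu> > - 1 / 2"
    and "det m = 1" and "m $ 1 $ 2 \<noteq> 0"
    and "1 \<le> p" and "1 \<le> q" and "1 \<le> r"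
    and "inverse p + inverse q = inverse r + 1"
    and "f \<in> bessel_Lp \<nu> p" and "g \<in> bessel_Lp \<nu> q"
  shows "(AE x in bessel_measure \<nu>. gen_convolution_exists \<nu> m f g x) \<and>
    gen_convolution \<nu> m f g \<in> bessel_Lp \<nu> r \<and>
    bessel_norm \<nu> r (gen_convolution \<nu> m f g) \<le> bessel_norm \<nu> p f * bessel_norm \<nu> q g"
proof -
  define k where "k = m $ 2 $ 2 / m $ 1 $ 2"
  let ?h = "bessel_convolution \<nu> (chirp k f) (chirp k g)"
  note Young = bessel_convolution_Young[OF assms(1,4-7) chirp_in_bessel_Lp[OF assms(8)]
      chirp_in_bessel_Lp[OF assms(9)], of k k, unfolded bessel_norm_chirp]
  \<comment> \<open>The remaining phase in the variable of the convolution is a chirp of opposite sign.\<close>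
  have eq: "gen_convolution \<nu> m f g = chirp (- k) ?h"
    by (simp add: fun_eq_iff gen_convolution_eq[OF k_def] chirp_def)
  show ?thesis
    unfolding eq bessel_norm_chirp using Young
    by (auto intro: chirp_in_bessel_Lp gen_convolution_exists_if[OF k_def] elim!: eventually_mono)
qed

end
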